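(* Let $\lambda\in\{0,\infty\}$. Then for every point $\omega\in\mathbb S^2$ and every $Q_b(\omega)=v\otimes v-\frac13I$ with $v\in\mathbb S^2$, $v\cdot\omega=0$, $$D_\lambda(Q_b(\omega))\ \ge\ D_\lambda(Q_\phi(\omega)).$$
   Context: $\mathcal S_0$ is the space of symmetric traceless real $3\times3$ matrices with the Frobenius norm $|\cdot|$. $Q_\infty=\mathbf e_3\otimes \mathbf e_3-\frac13I$. Potentials: $f(Q)=\frac29-\frac12|Q|^2-\operatorname{tr}(Q^3)+\frac34|Q|^4$, which satisfies $f\ge0$ with equality iff $Q=n\otimes n-\frac13I$ for some $n\in\mathbb S^2$; and $g(Q)=\sqrt{\frac23}-\frac{Q_{33}}{|Q|}$ (the formula is for $Q\neq 0$; no value at $Q=0$ is specified). For $Q\in Q_\infty+H^1((1,\infty);\mathcal S_0)$: $F_0(Q)=\int_1^\infty\left[\frac12\left|\frac{dQ}{dr}\right|^2+g(Q)\right]dr$; and $F_\infty(Q)=\int_1^\infty\left[\frac12\left|\frac{dQ}{dr}\right|^2+g(Q)\right]dr$ if $f(Q)=0$ a.e., $F_\infty(Q)=+\infty$ otherwise. For $\lambda\in\{0,\infty\}$, $$D_\lambda(Q_0)=\min\{F_\lambda(Q): Q\in Q_\infty+H^1((1,\infty);\mathcal S_0),\ Q(1)=Q_0\}.$$ $Q_\phi=e_\phi\otimes e_\phi-\frac13I$, where $e_\phi$ is the longitudinal unit tangent vector: at $\omega=(\sin\phi\cos\theta,\sin\phi\sin\theta,\cos\phi)$, $\theta\in[0,2\pi)$,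 $\phi\in(0,\pi)$, $e_\phi=(\cos\phi\cos\theta,\cos\phi\sin\theta,-\sin\phi)$. At the poles $\omega=\pm \mathbf e_3$, $e_\phi$ denotes an arbitrary unit vector orthogonal to $\mathbf e_3$.
   Formalization: D_λ is taken as the infimum instead of the minimum, because for λ=0 the minimum is not attained when Q_0≠Q_∞ is uniaxial (the two agree whenever a minimum exists); the unspecified value g(0) is allowed to be any nonnegative number. *)

theory Defs
  imports "HOL-Analysis.Analysis"
begin

section \<open>Q-tensors and the two potentials\<close>

text \<open>The Euclidean norm of the type \<open>real ^ 3 ^ 3\<close> is the Frobenius norm.\<close>

definition S0 :: "(real ^ 3 ^ 3) set" where
  "S0 = {Q. transpose Q = Q \<and> trace Q = 0}"

definition uniax :: "real ^ 3 \<Rightarrow> real ^ 3 ^ 3" where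
  "uniax n = (\<chi> i j. n $ i * n $ j) - (1 / 3) *\<^sub>R mat 1"

definition Q_infty :: "real ^ 3 ^ 3" where
  "Q_infty = uniax (axis 3 1)"

definition f_bulk :: "real ^ 3 ^ 3 \<Rightarrow> real" where
  "f_bulk Q = 2 / 9 - 1 / 2 * norm Q ^ 2 - trace (Q ** Q ** Q) + 3 / 4 * norm Q ^ 4"

text \<open>The formula for the potential \<open>g\<close> has no meaning at \<open>Q = 0\<close>. Instead of inheriting
  the value that \<open>x / 0 = 0\<close> would give, we make the value \<open>g0\<close> at \<open>0\<close> an explicit parameter.\<close>

definition g_ext :: "real \<Rightarrow> real ^ 3 ^ 3 \<Rightarrow> real" where
  "g_ext g0 Q = (if Q = 0 then g0 else sqrt (2 / 3) - Q $ 3 $ 3 / norm Q)"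

section \<open>Sobolev functions on the half-line\<close>

definition L2 :: "(real \<Rightarrow> 'a::euclidean_space) \<Rightarrow> bool" where
  "L2 u \<longleftrightarrow> u \<in> borel_measurable (lebesgue_on {1<..}) \<and>
     integrable (lebesgue_on {1<..}) (\<lambda>r. norm (u r) ^ 2)"

text \<open>Test functions are the compactly supported \<open>C\<^sup>1\<close> functions on \<open>(1, \<infinity>)\<close>, extended by \<open>0\<close>.\<close>

definition test_fun :: "(real \<Rightarrow> real) \<Rightarrow> bool" where
  "test_fun \<psi> \<longleftrightarrow> \<psi> C1_differentiable_on UNIV \<and>
     (\<exists>K. compact K \<and> K \<subseteq> {1<..} \<and> (\<forall>r. r \<notin> K \<longrightarrow> \<psi> r = 0))"

definition weak_derivative ::
    "(real \<Rightarrow> 'a::euclidean_space) \<Rightarrow> (real \<Rightarrow> 'a) \<Rightarrow> bool" where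
  "weak_derivative u w \<longleftrightarrow> (\<forall>\<psi>. test_fun \<psi> \<longrightarrow>
     (LINT r|lebesgue_on {1<..}. deriv \<psi> r *\<^sub>R u r) =
     - (LINT r|lebesgue_on {1<..}. \<psi> r *\<^sub>R w r))"

definition H1 :: "(real \<Rightarrow> 'a::euclidean_space) set" where
  "H1 = {u. L2 u \<and> (\<exists>w. L2 w \<and> weak_derivative u w)}"

text \<open>Weak derivatives are unique only up to null sets; a representative is chosen. It is used
  below for functions in \<open>Q_infty + H1\<close> only, which have a weak derivative in \<open>L2\<close>.\<close>

definition wderiv :: "(real \<Rightarrow> 'a::euclidean_space) \<Rightarrow> real \<Rightarrow> 'a" where
  "wderiv u = (SOME w. L2 w \<and> weak_derivative u w)"

text \<open>The value of a Sobolev function at the end point \<open>1\<close> is that of its continuous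
  representative on \<open>[1, \<infinity>)\<close>.\<close>

definition trace_at_1 :: "(real \<Rightarrow> 'a::euclidean_space) \<Rightarrow> 'a \<Rightarrow> bool" where
  "trace_at_1 u a \<longleftrightarrow> (\<exists>v. continuous_on {1..} v \<and>
     (AE r in lebesgue_on {1<..}. v r = u r) \<and> v 1 = a)"

section \<open>The energies and their minimal values\<close>

text \<open>Both energy densities are nonnegative on \<open>S0\<close> if \<open>g0 \<ge> 0\<close> (lemma \<open>g_ext_nonneg\<close> below),
  so the energies are integrals of nonnegative functions, with values in \<open>[0, \<infinity>]\<close>.\<close>

definition F_zero :: "real \<Rightarrow> (real \<Rightarrow> real ^ 3 ^ 3) \<Rightarrow> ennreal" where
  "F_zero g0 Q = (\<integral>\<^sup>+ r. ennreal (1 / 2 * norm (wderiv Q r) ^ 2 + g_ext g0 (Q r))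
     \<partial>lebesgue_on {1<..})"

definition F_infty :: "real \<Rightarrow> (real \<Rightarrow> real ^ 3 ^ 3) \<Rightarrow> ennreal" where
  "F_infty g0 Q =
     (if AE r in lebesgue_on {1<..}. f_bulk (Q r) = 0
      then \<integral>\<^sup>+ r. ennreal (1 / 2 * norm (wderiv Q r) ^ 2 + g_ext g0 (Q r))
             \<partial>lebesgue_on {1<..}
      else \<infinity>)"

datatype regime = Lambda_zero | Lambda_infty

fun F :: "real \<Rightarrow> regime \<Rightarrow> (real \<Rightarrow> real ^ 3 ^ 3) \<Rightarrow> ennreal" where
  "F g0 Lambda_zero Q = F_zero g0 Q"
| "F g0 Lambda_infty Q = F_infty g0 Q"

definition admissible :: "real ^ 3 ^ 3 \<Rightarrow> (real \<Rightarrow> real ^ 3 ^ 3) set" where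
  "admissible Q0 = {Q. (\<forall>r>1. Q r \<in> S0) \<and> (\<lambda>r. Q r - Q_infty) \<in> H1 \<and> trace_at_1 Q Q0}"

text \<open>The minimal value is taken to be the infimum, which agrees with the minimum whenever the
  latter exists (lemma \<open>D_eq_minimum\<close> below). For \<open>Lambda_zero\<close> it need not exist: with
  \<open>c = sqrt (2 / 3)\<close> and \<open>S Q = sqrt c * norm Q - Q $ 3 $ 3 / sqrt c\<close> the gradient of \<open>S\<close> in \<open>S0\<close>
  satisfies \<open>norm (grad S) ^ 2 = 2 * g\<close> away from \<open>0\<close>, so that the energy of an admissible \<open>Q\<close>
  is at least \<open>S Q0\<close>, and this bound is the infimum (follow the gradient flow of \<open>- S\<close> up to a
  small distance from the ray spanned by \<open>Q_infty\<close>, where \<open>g = 0\<close>, then move slowly along it).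
  Equality would force \<open>Q\<close> to be the gradient flow itself, along which \<open>norm Q\<close> is
  nonincreasing, and strictly decreasing initially unless \<open>Q0\<close> is on that ray. Hence it cannot
  converge to \<open>Q_infty\<close> if \<open>norm Q0 = norm Q_infty\<close> and \<open>Q0 \<noteq> Q_infty\<close>.\<close>

definition D :: "real \<Rightarrow> regime \<Rightarrow> real ^ 3 ^ 3 \<Rightarrow> ennreal" where
  "D g0 lam Q0 = (INF Q \<in> admissible Q0. F g0 lam Q)"

lemma D_eq_minimum:
  assumes "Q \<in> admissible Q0" and "\<And>P. P \<in> admissible Q0 \<Longrightarrow> F g0 lam Q \<le> F g0 lam P"
  shows "D g0 lam Q0 = F g0 lam Q"
  unfolding D_def by (rule antisym) (auto intro: INF_lower INF_greatest assms)

lemma g_ext_nonneg: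
  assumes "Q \<in> S0" and "0 \<le> g0"
  shows "0 \<le> g_ext g0 Q"
proof (cases "Q = 0")
  case True
  then show ?thesis using assms by (simp add: g_ext_def)
next
  case False
  have tr: "Q $ 1 $ 1 + Q $ 2 $ 2 + Q $ 3 $ 3 = 0"
    using assms(1) by (simp add: S0_def trace_def sum_3)
  have nrm: "norm Q ^ 2 = (\<Sum>i\<in>UNIV. \<Sum>j\<in>UNIV. (Q $ i $ j) ^ 2)"
    unfolding power2_norm_eq_inner by (simp add: inner_vec_def power2_eq_square)
  have "(Q $ 1 $ 1) ^ 2 + (Q $ 2 $ 2) ^ 2 + (Q $ 3 $ 3) ^ 2 \<le> norm Q ^ 2"
    unfolding nrm by (simp add: sum_3)
  moreover have "Q $ 3 $ 3 = - (Q $ 1 $ 1 + Q $ 2 $ 2)"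
    using tr by linarith
  then have "(Q $ 3 $ 3) ^ 2 = (Q $ 1 $ 1 + Q $ 2 $ 2) ^ 2"
    by (metis power2_minus)
  then have "(Q $ 3 $ 3) ^ 2 \<le> 2 * ((Q $ 1 $ 1) ^ 2 + (Q $ 2 $ 2) ^ 2)"
    using sum_squares_ge_zero[of "Q $ 1 $ 1 - Q $ 2 $ 2" 0]
    by (simp add: power2_eq_square algebra_simps)
  ultimately have "(Q $ 3 $ 3) ^ 2 \<le> 2 / 3 * norm Q ^ 2"
    by (simp add: field_simps)
  then have "\<bar>Q $ 3 $ 3\<bar> \<le> sqrt (2 / 3) * norm Q"
    by (metis norm_ge_zero real_sqrt_abs real_sqrt_le_mono real_sqrt_mult abs_norm_cancel)
  then show ?thesis
    using False by (simp add: g_ext_def divide_le_eq abs_le_iff)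
qed

section \<open>The longitudinal tangent vector\<close>

text \<open>The set of admissible values of \<open>e\<^sub>\<phi>\<close> at \<open>\<omega>\<close>: a singleton away from the poles, all horizontal
  unit vectors at the poles.\<close>

definition e_phi :: "real ^ 3 \<Rightarrow> (real ^ 3) set" where
  "e_phi \<omega> =
     (if \<omega> = axis 3 1 \<or> \<omega> = - axis 3 1
      then {e. norm e = 1 \<and> e \<bullet> axis 3 1 = 0}
      else {vector [cos \<phi> * cos \<theta>, cos \<phi> * sin \<theta>, - sin \<phi>] | \<theta> \<phi>.
              0 \<le> \<theta> \<and> \<theta> < 2 * pi \<and> 0 < \<phi> \<and> \<phi> < pi \<and>
              \<omega> = vector [sin \<phi> * cos \<theta>, sin \<phi> * sin \<theta>, cos \<phi>]})"

lemma e_phi_nonempty: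
  assumes "norm \<omega> = 1"
  shows "e_phi \<omega> \<noteq> {}"
proof (cases "\<omega> = axis 3 1 \<or> \<omega> = - axis 3 1")
  case True
  have "axis 1 1 \<in> e_phi \<omega>"
    using True by (simp add: e_phi_def inner_axis norm_eq_1 axis_def inner_vec_def sum_3)
  then show ?thesis by blast
next
  case False
  have nrm: "(\<omega> $ 1) ^ 2 + (\<omega> $ 2) ^ 2 + (\<omega> $ 3) ^ 2 = 1"
    using assms by (simp add: norm_eq_1 inner_vec_def sum_3 power2_eq_square)
  have ne: "(\<omega> $ 1) ^ 2 + (\<omega> $ 2) ^ 2 \<noteq> 0"
  proof
    assume "(\<omega> $ 1) ^ 2 + (\<omega> $ 2) ^ 2 = 0"
    then have *: "\<omega> $ 1 = 0" "\<omega> $ 2 = 0" "(\<omega> $ 3) ^ 2 = 1"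
      using nrm by (auto simp: sum_power2_eq_zero_iff)
    then have "\<omega> $ 3 = 1 \<or> \<omega> $ 3 = - 1" by (simp add: power2_eq_1_iff)
    with * have "\<omega> = axis 3 1 \<or> \<omega> = - axis 3 1"
      by (auto simp: vec_eq_iff forall_3 axis_def)
    with False show False by blast
  qed
  define s where "s = sqrt ((\<omega> $ 1) ^ 2 + (\<omega> $ 2) ^ 2)"
  have s2: "s ^ 2 = (\<omega> $ 1) ^ 2 + (\<omega> $ 2) ^ 2" by (simp add: s_def)
  have s0: "0 < s" using ne unfolding s_def
    by (simp add: less_le)
  have "(\<omega> $ 1 / s) ^ 2 + (\<omega> $ 2 / s) ^ 2 = 1"
    using s0 by (simp add: power_divide add_divide_distrib[symmetric] s2[symmetric])
  then obtain \<theta> where th: "0 \<le> \<theta>" "\<theta> < 2 * pi" "\<omega> $ 1 / s = cos \<theta>" "\<omega> $ 2 / s = sin \<theta>"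
    using sincos_total_2pi by blast
  define \<phi> where "\<phi> = arccos (\<omega> $ 3)"
  have lt: "(\<omega> $ 3) ^ 2 < 1" using nrm s2 s0 by (smt (verit) zero_less_power)
  then have b: "- 1 < \<omega> $ 3" "\<omega> $ 3 < 1" by (auto simp: power2_less_1_iff abs_square_less_1 abs_less_iff)
  then have ph: "0 < \<phi>" "\<phi> < pi" "cos \<phi> = \<omega> $ 3"
    using arccos_lt_bounded[of "\<omega> $ 3"] by (auto simp: \<phi>_def)
  have "sin \<phi> ^ 2 = s ^ 2" using nrm ph(3) s2 by (simp add: sin_squared_eq)
  then have sp: "sin \<phi> = s"
    using sin_gt_zero[OF ph(1,2)] s0 by (simp add: power2_eq_iff)
  have "\<omega> = vector [sin \<phi> * cos \<theta>, sin \<phi> * sin \<theta>, cos \<phi>]"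
    using s0 by (simp add: vec_eq_iff forall_3 sp ph(3) th(3,4)[symmetric])
  then have "vector [cos \<phi> * cos \<theta>, cos \<phi> * sin \<theta>, - sin \<phi>] \<in> e_phi \<omega>"
    using False th(1,2) ph(1,2) unfolding e_phi_def if_not_P[OF False] by blast
  then show ?thesis by blast
qed

end

theory Submission
  imports Defs
begin

text \<open>Among the unit vectors orthogonal to \<open>\<omega>\<close>, \<open>e\<^sub>\<phi>\<close> is as close to the axis \<open>\<plusminus>e\<^sub>3\<close> as possible, so that the
  angle between \<open>Q\<^sub>b\<close> and \<open>Q\<^sub>\<infinity>\<close> is at least the angle \<open>\<beta>\<close> between \<open>Q\<^sub>\<phi>\<close> and \<open>Q\<^sub>\<infinity>\<close>. A competitor for \<open>Q\<^sub>\<phi>\<close>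
  arises from an admissible \<open>Q\<close> for \<open>Q\<^sub>b\<close> by composing its continuous representative with the map \<open>T\<close>
  that folds the space around the axis into a half-plane and replaces the polar angle by its minimum
  with \<open>\<beta>\<close>. The map \<open>T\<close> is 1-Lipschitz and does not increase \<open>g\<close>. For \<open>\<lambda> = 0\<close> it acts on \<open>S\<^sub>0\<close> with axis
  \<open>Q\<^sub>\<infinity>\<close>. For \<open>\<lambda> = \<infinity>\<close> it acts on the directors \<open>n\<close> with axis \<open>e\<^sub>3\<close>, the zero set of \<open>f\<close> in \<open>S\<^sub>0\<close> being the set of all
  \<open>n \<otimes> n - I/3\<close> because \<open>f(Q) = 3/2 |Q\<^sup>2 - Q/3 - 2I/9|\<^sup>2\<close>.

  Instead of a chain rule for the Lipschitz map \<open>T\<close>, only \<open>|P(t) - P(s)| \<le> |Q(t) - Q(s)| \<le> \<integral>\<^sub>s\<^sup>t |Q'|\<close> is used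
  for \<open>P = T \<circ> Q\<close>: the Radon-Nikodym theorem yields the weak derivative of \<open>P\<close>, and comparing integrals over
  intervals yields \<open>|P'| \<le> |Q'|\<close> almost everywhere.\<close>

section \<open>Densities of functions on the line\<close>

text \<open>Half-open intervals form an intersection-stable generator of the Borel sets, and the
  intervals \<open>{- real n<..real n}\<close> of finite measure exhaust the line, so uniqueness of
  measures applies.\<close>

lemma eq_interval_measureI:
  assumes sets: "sets N = sets borel"
    and cont: "continuous_on UNIV H"
    and N: "\<And>a b. a \<le> b \<Longrightarrow> emeasure N {a<..b} = ennreal (H b - H a)"
    and mono: "mono H"
  shows "N = interval_measure H"
proof (rule measure_eqI_generator_eq[where \<Omega> = UNIV and E = "range (\<lambda>(a, b). {a<..b::real})"
      and A = "\<lambda>n. {- real n<..real n}"])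
  have IM: "emeasure (interval_measure H) {a<..b} = ennreal (H b - H a)" if "a \<le> b" for a b
    using that mono cont
    by (intro emeasure_interval_measure_Ioc) (auto simp: mono_def continuous_on_eq_continuous_within
        intro: continuous_within_subset)
  show "emeasure N X = emeasure (interval_measure H) X" if "X \<in> range (\<lambda>(a, b). {a<..b::real})" for X
  proof -
    from that obtain a b where "X = {a<..b}" by auto
    then show ?thesis
      by (cases "a \<le> b") (simp_all add: N IM)
  qed
  show "emeasure N {- real n<..real n} \<noteq> \<infinity>" for n
    by (subst N) auto
  show "Int_stable (range (\<lambda>(a, b). {a<..b::real}))"
    by (auto simp: Int_stable_def)
  show "(\<Union>n. {- real n<..real n}) = UNIV"
  proof (intro set_eqI iffI UNIV_I)
    fix x :: real
    obtain n where "\<bar>x\<bar> < real n" using reals_Archimedean2 by blast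
    then show "x \<in> (\<Union>n. {- real n<..real n})" by (intro UN_I[of n]) auto
  qed
qed (auto simp: sets borel_sigma_sets_Ioc)

text \<open>The Stieltjes measures of \<open>K\<close> and of the monotone function
  \<open>H - K\<close> add up to that of \<open>H\<close>, because both sides agree on half-open
  intervals.\<close>

lemma emeasure_interval_measure_mono:
  assumes K: "mono K" "continuous_on UNIV K"
    and D: "mono (\<lambda>x. H x - K x)" and H: "continuous_on UNIV H"
    and A: "A \<in> sets borel"
  shows "emeasure (interval_measure K) A \<le> emeasure (interval_measure H) A"
proof -
  let ?D = "\<lambda>x. H x - K x"
  define S where "S = measure_of UNIV (sets borel)
    (\<lambda>A. emeasure (interval_measure K) A + emeasure (interval_measure ?D) A)"
  have sets_S: "sets S = sets borel"
    using sets.sigma_sets_eq[of "borel :: real measure"] by (simp add: S_def)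
  have D': "continuous_on UNIV ?D" by (intro continuous_intros K H)
  have S: "emeasure S A = emeasure (interval_measure K) A + emeasure (interval_measure ?D) A"
    if "A \<in> sets borel" for A
  proof (rule emeasure_measure_of[OF S_def])
    show "countably_additive (sets S)
        (\<lambda>A. emeasure (interval_measure K) A + emeasure (interval_measure ?D) A)"
    proof (rule countably_additiveI)
      fix B :: "nat \<Rightarrow> real set" assume B: "range B \<subseteq> sets S" "disjoint_family B"
      then have B': "range B \<subseteq> sets borel" by (simp add: sets_S)
      show "(\<Sum>i. emeasure (interval_measure K) (B i) + emeasure (interval_measure ?D) (B i)) =
          emeasure (interval_measure K) (\<Union>i. B i) + emeasure (interval_measure ?D) (\<Union>i. B i)"
        using B' B(2) by (subst suminf_add[symmetric]) (auto simp: suminf_emeasure)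
    qed
  qed (use that in \<open>auto simp: S_def positive_def\<close>)
  have IM: "emeasure (interval_measure J) {a<..b} = ennreal (J b - J a)"
    if "a \<le> b" "mono J" "continuous_on UNIV J" for a b J
    using that
    by (intro emeasure_interval_measure_Ioc) (auto simp: mono_def continuous_on_eq_continuous_within
        intro: continuous_within_subset)
  have "S = interval_measure H"
  proof (rule eq_interval_measureI)
    show "mono H"
      using K(1) D by (fastforce simp: mono_def)
    show "emeasure S {a<..b} = ennreal (H b - H a)" if "a \<le> b" for a b
      using that K D D' by (simp add: S IM ennreal_plus[symmetric] mono_def del: ennreal_plus)
  qed (auto simp: sets_S H)
  then have "emeasure (interval_measure H) A =
      emeasure (interval_measure K) A + emeasure (interval_measure ?D) A"
    using S[OF A] by simp
  then show ?thesis
    by simp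
qed

lemma exists_primitive:
  fixes w :: "real \<Rightarrow> 'a::euclidean_space"
  assumes w: "\<And>a b. set_integrable lborel {a<..b} w"
  shows "\<exists>W. continuous_on UNIV W \<and> (\<forall>a b. a \<le> b \<longrightarrow> W b - W a = (LINT x:{a<..b}|lborel. w x))"
proof -
  have split: "(LINT x:{a<..c}|lborel. w x) = (LINT x:{a<..b}|lborel. w x) + (LINT x:{b<..c}|lborel. w x)"
    if "a \<le> b" "b \<le> c" for a b c
  proof -
    have "{a<..c} = {a<..b} \<union> {b<..c}" using that by auto
    then show ?thesis
      using set_integral_Un[OF _ w[of a b] w[of b c]] by (auto simp: disjoint_iff)
  qed
  define W where "W t = (if 0 \<le> t then (LINT x:{0<..t}|lborel. w x) else - (LINT x:{t<..0}|lborel. w x))" for t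
  have W: "W b - W a = (LINT x:{a<..b}|lborel. w x)" if "a \<le> b" for a b
  proof -
    consider "0 \<le> a" | "a < 0" "0 \<le> b" | "b < 0" by linarith
    then show ?thesis
    proof cases
      case 1 then show ?thesis using split[of 0 a b] that by (simp add: W_def)
    next
      case 2 then show ?thesis using split[of a 0 b] that by (simp add: W_def)
    next
      case 3 then show ?thesis using split[of a b 0] that by (simp add: W_def)
    qed
  qed
  \<comment> \<open>Continuity is local: on \<open>{c - 1..c + 1}\<close>, \<open>W\<close> differs
    by a constant from an indefinite Henstock-Kurzweil integral. The left end point, absent from
    \<open>{?a<..t}\<close>, is a null set.\<close>
  have "isCont W c" for c
  proof -
    let ?a = "c - 1" and ?b = "c + 1"
    have eq: "(LINT x:{?a<..t}|lborel. w x) = integral {?a..t} w" if "?a \<le> t" for t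
    proof -
      have "(LINT x:{?a<..t}|lborel. w x) = integral {?a<..t} w"
        by (rule set_borel_integral_eq_integral(2)[OF w])
      also have "\<dots> = integral {?a..t} w"
        by (rule integral_spike_set; rule negligible_subset[of "{?a}"]) auto
      finally show ?thesis .
    qed
    have "w integrable_on {?a..?b}"
      by (rule integrable_spike_set[OF set_borel_integral_eq_integral(1)[OF w[of ?a ?b]]]; rule negligible_subset[of "{?a}"]) auto
    then have "continuous_on {?a..?b} (\<lambda>t. W ?a + integral {?a..t} w)"
      by (intro continuous_intros indefinite_integral_continuous_1)
    then have "continuous_on {?a<..<?b} (\<lambda>t. W ?a + integral {?a..t} w)"
      by (rule continuous_on_subset) auto
    then have "continuous_on {?a<..<?b} W"
    proof (rule continuous_on_eq)
      fix t assume "t \<in> {?a<..<?b}"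
      then show "W ?a + integral {?a..t} w = W t"
        using W[of ?a t] eq[of t] by (simp add: algebra_simps)
    qed
    then show ?thesis
      by (simp add: continuous_on_eq_continuous_at)
  qed
  then show ?thesis
    using W by (intro exI[of _ W]) (auto simp: continuous_on_eq_continuous_at)
qed

lemma density_eq_interval_measure:
  fixes w :: "real \<Rightarrow> real"
  assumes meas [measurable]: "w \<in> borel_measurable borel" and nonneg: "\<And>x. 0 \<le> w x"
    and w: "\<And>a b. set_integrable lborel {a<..b} w"
    and W: "continuous_on UNIV W" "\<And>a b. a \<le> b \<Longrightarrow> W b - W a = (LINT x:{a<..b}|lborel. w x)"
  shows "mono W" "density lborel w = interval_measure W"
proof -
  show "mono W"
  proof (rule monoI)
    fix a b :: real assume "a \<le> b"
    then have "W b - W a \<ge> 0"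
      by (simp add: W(2) set_lebesgue_integral_def nonneg)
    then show "W a \<le> W b" by simp
  qed
  then show "density lborel w = interval_measure W"
  proof (intro eq_interval_measureI)
    fix a b :: real assume "a \<le> b"
    have "emeasure (density lborel w) {a<..b} = (\<integral>\<^sup>+x. ennreal (indicator {a<..b} x *\<^sub>R w x) \<partial>lborel)"
      by (subst emeasure_density) (auto intro!: nn_integral_cong simp: indicator_def)
    also have "\<dots> = ennreal (W b - W a)"
      using w[of a b] \<open>a \<le> b\<close> unfolding W(2)[OF \<open>a \<le> b\<close>] set_lebesgue_integral_def set_integrable_def
      by (intro nn_integral_eq_integral) (auto simp: nonneg)
    finally show "emeasure (density lborel w) {a<..b} = ennreal (W b - W a)" .
  qed (auto intro: W)
qed

text \<open>The hypothesis makes the difference of the primitives \<open>P\<close> and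
  \<open>N\<close> of the positive and negative parts monotone. Hence the measure with density
  \<open>?n\<close> is dominated by that with density \<open>?p\<close>, which gives no mass to the
  set where \<open>h\<close> is negative.\<close>

lemma AE_nonneg_if_integrals_nonneg:
  fixes h :: "real \<Rightarrow> real"
  assumes meas [measurable]: "h \<in> borel_measurable borel"
    and h: "\<And>a b. set_integrable lborel {a<..b} h"
    and le: "\<And>a b. a \<le> b \<Longrightarrow> 0 \<le> (LINT x:{a<..b}|lborel. h x)"
  shows "AE x in lborel. 0 \<le> h x"
proof -
  let ?p = "\<lambda>x. max 0 (h x)" and ?n = "\<lambda>x. max 0 (- h x)"
  have p: "set_integrable lborel {a<..b} ?p" for a b
    using h[of a b] unfolding set_integrable_def
    by (rule Bochner_Integration.integrable_bound) (auto simp: indicator_def)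
  have n: "set_integrable lborel {a<..b} ?n" for a b
    using h[of a b] unfolding set_integrable_def
    by (rule Bochner_Integration.integrable_bound) (auto simp: indicator_def)
  obtain P where P: "continuous_on UNIV P" "\<And>a b. a \<le> b \<Longrightarrow> P b - P a = (LINT x:{a<..b}|lborel. ?p x)"
    using exists_primitive[OF p] by blast
  obtain N where N: "continuous_on UNIV N" "\<And>a b. a \<le> b \<Longrightarrow> N b - N a = (LINT x:{a<..b}|lborel. ?n x)"
    using exists_primitive[OF n] by blast
  note dp = density_eq_interval_measure[of ?p, OF _ _ p P] and dn = density_eq_interval_measure[of ?n, OF _ _ n N]
  have "mono (\<lambda>x. P x - N x)"
  proof (rule monoI)
    fix a b :: real assume ab: "a \<le> b"
    have "(P b - P a) - (N b - N a) = (LINT x:{a<..b}|lborel. ?p x - ?n x)"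
      unfolding P(2)[OF ab] N(2)[OF ab] by (rule set_integral_diff(2)[symmetric]) (rule p n)+
    also have "(\<lambda>x. ?p x - ?n x) = h"
      by (auto simp: fun_eq_iff)
    finally show "P a - N a \<le> P b - N b"
      using le[OF ab] by linarith
  qed
  then have le': "emeasure (density lborel ?n) A \<le> emeasure (density lborel ?p) A" if "A \<in> sets borel" for A
    using emeasure_interval_measure_mono[of N P A] dn(1) N(1) P(1) that by (simp add: dp(2) dn(2))
  let ?A = "{x. h x < 0}"
  have A [measurable]: "?A \<in> sets borel" by measurable
  have "emeasure (density lborel ?p) ?A = (\<integral>\<^sup>+x. ennreal (?p x) * indicator ?A x \<partial>lborel)"
    by (rule emeasure_density) auto
  also have "\<dots> = (\<integral>\<^sup>+(x :: real). 0 \<partial>lborel)"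
    by (rule nn_integral_cong) (auto simp: indicator_def)
  finally have "emeasure (density lborel ?n) ?A = 0"
    using le'[OF A] by simp
  then have "?A \<in> null_sets (density lborel ?n)"
    by (auto intro: null_setsI)
  then have "AE x in lborel. x \<in> ?A \<longrightarrow> ennreal (?n x) = 0"
    by (subst (asm) null_sets_density_iff) auto
  then show ?thesis
    by eventually_elim (auto simp: ennreal_eq_0_iff not_le)
qed

text \<open>Adding a primitive of \<open>k\<close> turns \<open>p\<close> into a monotone function whose Stieltjes measure is
  dominated by the density \<open>2 k\<close>, so that the Radon-Nikodym theorem applies.\<close>

lemma exists_density_real:
  fixes p :: "real \<Rightarrow> real"
  assumes meas [measurable]: "k \<in> borel_measurable borel" and nonneg: "\<And>x. 0 \<le> k x"
    and k: "\<And>a b. set_integrable lborel {a<..b} k"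
    and cont: "continuous_on UNIV p"
    and le: "\<And>a b. a \<le> b \<Longrightarrow> \<bar>p b - p a\<bar> \<le> (LINT x:{a<..b}|lborel. k x)"
  shows "\<exists>w\<in>borel_measurable borel. \<forall>a b. set_integrable lborel {a<..b} w \<and>
    (a \<le> b \<longrightarrow> p b - p a = (LINT x:{a<..b}|lborel. w x))"
proof -
  obtain K where K: "continuous_on UNIV K" "\<And>a b. a \<le> b \<Longrightarrow> K b - K a = (LINT x:{a<..b}|lborel. k x)"
    using exists_primitive[OF k] by blast
  let ?P = "\<lambda>x. p x + K x" and ?K2 = "\<lambda>x. 2 * K x"
  have P: "mono ?P" "continuous_on UNIV ?P"
  proof (rule monoI)
    fix a b :: real assume "a \<le> b"
    then show "?P a \<le> ?P b" using le[of a b] K(2)[of a b] by linarith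
  qed (intro continuous_intros cont K)
  have "mono (\<lambda>x. ?K2 x - ?P x)"
  proof (rule monoI)
    fix a b :: real assume "a \<le> b"
    then show "?K2 a - ?P a \<le> ?K2 b - ?P b" using le[of a b] K(2)[of a b] by linarith
  qed
  then have le': "emeasure (interval_measure ?P) A \<le> emeasure (interval_measure ?K2) A" if "A \<in> sets borel" for A
    using that K(1) by (intro emeasure_interval_measure_mono P) (auto intro!: continuous_intros)
  have dens: "density lborel (\<lambda>x. 2 * k x) = interval_measure ?K2"
  proof (rule density_eq_interval_measure(2))
    show "?K2 b - ?K2 a = (LINT x:{a<..b}|lborel. 2 * k x)" if "a \<le> b" for a b
      using K(2)[OF that] by simp
  qed (use k nonneg K(1) in \<open>auto intro!: continuous_intros set_integrable_mult_right\<close>)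
  have "absolutely_continuous lborel (interval_measure ?P)"
    unfolding absolutely_continuous_def
  proof
    fix A :: "real set" assume A: "A \<in> null_sets lborel"
    then have "A \<in> null_sets (density lborel (\<lambda>x. 2 * k x))"
      using absolutely_continuousI_density[of "\<lambda>x. ennreal (2 * k x)" lborel]
      by (auto simp: absolutely_continuous_def)
    then have "emeasure (interval_measure ?K2) A = 0"
      by (auto simp: dens)
    then have "emeasure (interval_measure ?P) A = 0"
      using le'[of A] A by (auto simp: null_sets_def)
    then show "A \<in> null_sets (interval_measure ?P)"
      using A by (auto simp: null_sets_def)
  qed
  then obtain d where [measurable]: "d \<in> borel_measurable lborel" and d: "density lborel d = interval_measure ?P"
    using sigma_finite_measure.Radon_Nikodym[OF sigma_finite_lborel, of "interval_measure ?P"] by auto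
  have int: "(\<integral>\<^sup>+x. d x * indicator {a<..b} x \<partial>lborel) = ennreal (?P b - ?P a)" if "a \<le> b" for a b
  proof -
    have "(\<integral>\<^sup>+x. d x * indicator {a<..b} x \<partial>lborel) = emeasure (density lborel d) {a<..b}"
      by (subst emeasure_density) auto
    also have "\<dots> = ennreal (?P b - ?P a)"
      unfolding d using that P
      by (intro emeasure_interval_measure_Ioc) (auto simp: mono_def continuous_on_eq_continuous_within
          intro: continuous_within_subset)
    finally show ?thesis .
  qed
  \<comment> \<open>Radon-Nikodym yields a density with values in \<open>ennreal\<close>. Its
    integrals over bounded intervals are finite, so it is finite almost everywhere and may be made
    real-valued.\<close>
  have "AE x in lborel. \<forall>n. d x * indicator {- real n<..real n} x \<noteq> \<infinity>"
    by (subst AE_all_countable, intro allI nn_integral_PInf_AE) (auto simp: int)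
  then have fin: "AE x in lborel. d x \<noteq> \<infinity>"
  proof eventually_elim
    case (elim x)
    obtain n where "\<bar>x\<bar> < real n" using reals_Archimedean2 by blast
    then have "x \<in> {- real n<..real n}" by auto
    then show ?case using elim[rule_format, of n] by simp
  qed
  let ?d = "\<lambda>x. enn2real (d x)"
  have nnd: "(\<integral>\<^sup>+x. ennreal (indicator {a<..b} x *\<^sub>R ?d x) \<partial>lborel) = ennreal (?P b - ?P a)" if "a \<le> b" for a b
  proof -
    have "(\<integral>\<^sup>+x. ennreal (indicator {a<..b} x *\<^sub>R ?d x) \<partial>lborel) = (\<integral>\<^sup>+x. d x * indicator {a<..b} x \<partial>lborel)"
      using fin by (intro nn_integral_cong_AE, eventually_elim) (auto simp: indicator_def less_top)
    then show ?thesis using int[OF that] by simp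
  qed
  have hbi: "has_bochner_integral lborel (\<lambda>x. indicator {a<..b} x *\<^sub>R ?d x) (?P b - ?P a)" if "a \<le> b" for a b
    using nnd[OF that] P(1) that by (intro has_bochner_integral_nn_integral) (auto simp: mono_def)
  have si: "set_integrable lborel {a<..b} ?d" for a b
    using hbi[of a b] by (cases "a \<le> b") (auto simp: set_integrable_def has_bochner_integral_iff)
  show ?thesis
  proof (intro bexI[of _ "\<lambda>x. ?d x - k x"] allI conjI impI)
    fix a b :: real
    show "set_integrable lborel {a<..b} (\<lambda>x. ?d x - k x)"
      by (intro set_integral_diff(1) si k)
    assume ab: "a \<le> b"
    have "(LINT x:{a<..b}|lborel. ?d x - k x) = (?P b - ?P a) - (K b - K a)"
      using hbi[OF ab] K(2)[OF ab]
      by (subst set_integral_diff(2)[OF si k]) (simp add: set_lebesgue_integral_def has_bochner_integral_iff)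
    then show "p b - p a = (LINT x:{a<..b}|lborel. ?d x - k x)" by simp
  qed measurable
qed

section \<open>Vector-valued densities and their domination\<close>

text \<open>Each coordinate inherits the bound by \<open>k\<close>, so the real case applies to it;
  the coordinate densities are then reassembled.\<close>

lemma exists_density:
  fixes p :: "real \<Rightarrow> 'a::euclidean_space"
  assumes "k \<in> borel_measurable borel" and "\<And>x. 0 \<le> k x"
    and "\<And>a b. set_integrable lborel {a<..b} k"
    and cont: "continuous_on UNIV p"
    and le: "\<And>a b. a \<le> b \<Longrightarrow> norm (p b - p a) \<le> (LINT x:{a<..b}|lborel. k x)"
  shows "\<exists>w\<in>borel_measurable borel. \<forall>a b. set_integrable lborel {a<..b} w \<and>
    (a \<le> b \<longrightarrow> p b - p a = (LINT x:{a<..b}|lborel. w x))"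
proof -
  have "\<exists>w\<in>borel_measurable borel. \<forall>a b. set_integrable lborel {a<..b} w \<and>
      (a \<le> b \<longrightarrow> p b \<bullet> i - p a \<bullet> i = (LINT x:{a<..b}|lborel. w x))" if i: "i \<in> Basis" for i
  proof (rule exists_density_real)
    show "\<bar>p b \<bullet> i - p a \<bullet> i\<bar> \<le> (LINT x:{a<..b}|lborel. k x)" if "a \<le> b" for a b
      using order_trans[OF Basis_le_norm[OF i, of "p b - p a"] le[OF that]] by (simp add: inner_diff_left)
  qed (use assms in \<open>auto intro!: continuous_intros\<close>)
  then obtain w where w [measurable]: "\<And>i. i \<in> Basis \<Longrightarrow> w i \<in> borel_measurable borel"
    and si: "\<And>i a b. i \<in> Basis \<Longrightarrow> set_integrable lborel {a<..b} (w i)"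
    and eq: "\<And>i a b. i \<in> Basis \<Longrightarrow> a \<le> b \<Longrightarrow> p b \<bullet> i - p a \<bullet> i = (LINT x:{a<..b}|lborel. w i x)"
    by metis
  have hbi: "has_bochner_integral lborel (\<lambda>x. indicator {a<..b} x *\<^sub>R (\<Sum>i\<in>Basis. w i x *\<^sub>R i))
      (\<Sum>i\<in>Basis. (LINT x:{a<..b}|lborel. w i x) *\<^sub>R i)" for a b
  proof -
    have "has_bochner_integral lborel (\<lambda>x. \<Sum>i\<in>Basis. (indicator {a<..b} x *\<^sub>R w i x) *\<^sub>R i)
      (\<Sum>i\<in>Basis. (LINT x:{a<..b}|lborel. w i x) *\<^sub>R i)"
      using si[of _ a b] unfolding set_integrable_def set_lebesgue_integral_def
      by (intro has_bochner_integral_sum has_bochner_integral_scaleR_left has_bochner_integral_integrable) auto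
    then show ?thesis
      by (simp add: scaleR_sum_right)
  qed
  show ?thesis
  proof (intro bexI[of _ "\<lambda>x. \<Sum>i\<in>Basis. w i x *\<^sub>R i"] allI conjI impI)
    fix a b :: real
    show "set_integrable lborel {a<..b} (\<lambda>x. \<Sum>i\<in>Basis. w i x *\<^sub>R i)"
      using hbi by (auto simp: set_integrable_def has_bochner_integral_iff)
    assume ab: "a \<le> b"
    have "(LINT x:{a<..b}|lborel. (\<Sum>i\<in>Basis. w i x *\<^sub>R i)) = (\<Sum>i\<in>Basis. (LINT x:{a<..b}|lborel. w i x) *\<^sub>R i)"
      using hbi by (auto simp: set_lebesgue_integral_def has_bochner_integral_iff)
    also have "\<dots> = (\<Sum>i\<in>Basis. ((p b - p a) \<bullet> i) *\<^sub>R i)"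
      by (intro sum.cong refl) (simp add: eq[OF _ ab, symmetric] inner_diff_left)
    also have "\<dots> = p b - p a"
      by (rule euclidean_representation)
    finally show "p b - p a = (LINT x:{a<..b}|lborel. (\<Sum>i\<in>Basis. w i x *\<^sub>R i))" ..
  qed measurable
qed

text \<open>For a fixed vector \<xi> the scalar case gives
  \<open>\<xi> \<bullet> w x \<le> norm \<xi> * k x\<close> almost everywhere. A countable dense set
  of vectors has a common exceptional null set, continuity extends the bound to all \<xi>, and the
  choice \<open>\<xi> = w x\<close> concludes.\<close>

lemma AE_norm_le_if_integrals_le:
  fixes w :: "real \<Rightarrow> 'a::euclidean_space"
  assumes [measurable]: "w \<in> borel_measurable borel" "k \<in> borel_measurable borel"
    and nonneg: "\<And>x. 0 \<le> k x"
    and w: "\<And>a b. set_integrable lborel {a<..b} w" and k: "\<And>a b. set_integrable lborel {a<..b} k"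
    and le: "\<And>a b. a \<le> b \<Longrightarrow> norm (LINT x:{a<..b}|lborel. w x) \<le> (LINT x:{a<..b}|lborel. k x)"
  shows "AE x in lborel. norm (w x) \<le> k x"
proof -
  have pointwise: "AE x in lborel. 0 \<le> norm \<xi> * k x - \<xi> \<bullet> w x" for \<xi>
  proof (rule AE_nonneg_if_integrals_nonneg)
    have wi: "has_bochner_integral lborel (\<lambda>x. indicator {a<..b} x *\<^sub>R (\<xi> \<bullet> w x)) (\<xi> \<bullet> (LINT x:{a<..b}|lborel. w x))"
      for a b
    proof -
      have "has_bochner_integral lborel (\<lambda>x. \<xi> \<bullet> (indicator {a<..b} x *\<^sub>R w x)) (\<xi> \<bullet> (LINT x:{a<..b}|lborel. w x))"
        using w[of a b] unfolding set_integrable_def set_lebesgue_integral_def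
        by (intro has_bochner_integral_inner_right has_bochner_integral_integrable)
      then show ?thesis by simp
    qed
    have si: "set_integrable lborel {a<..b} (\<lambda>x. \<xi> \<bullet> w x)" for a b
      using wi by (auto simp: set_integrable_def has_bochner_integral_iff)
    have ki: "set_integrable lborel {a<..b} (\<lambda>x. norm \<xi> * k x)" for a b
      using k by (intro set_integrable_mult_right) auto
    show "set_integrable lborel {a<..b} (\<lambda>x. norm \<xi> * k x - \<xi> \<bullet> w x)" for a b
      by (intro set_integral_diff(1) ki si)
    fix a b :: real assume ab: "a \<le> b"
    have "\<xi> \<bullet> (LINT x:{a<..b}|lborel. w x) \<le> norm \<xi> * norm (LINT x:{a<..b}|lborel. w x)"
      by (rule norm_cauchy_schwarz)
    also have "\<dots> \<le> norm \<xi> * (LINT x:{a<..b}|lborel. k x)"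
      by (intro mult_left_mono le ab) auto
    finally show "0 \<le> (LINT x:{a<..b}|lborel. norm \<xi> * k x - \<xi> \<bullet> w x)"
      using wi[of a b]
      by (subst set_integral_diff(2)[OF ki si]) (simp add: set_lebesgue_integral_def has_bochner_integral_iff)
  qed measurable
  obtain C :: "'a set" where C: "countable C" "\<And>X. open X \<Longrightarrow> X \<noteq> {} \<Longrightarrow> \<exists>d\<in>C. d \<in> X"
    using countable_dense_setE by blast
  have "AE x in lborel. \<forall>\<xi>\<in>C. 0 \<le> norm \<xi> * k x - \<xi> \<bullet> w x"
    using C(1) pointwise by (simp add: AE_ball_countable)
  then show ?thesis
  proof eventually_elim
    case (elim x)
    have "open {\<xi>. norm \<xi> * k x - \<xi> \<bullet> w x < 0}"
      by (intro open_Collect_less continuous_intros)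
    then have "{\<xi>. norm \<xi> * k x - \<xi> \<bullet> w x < 0} = {}"
      using C(2) elim by (metis (no_types, lifting) linorder_not_less mem_Collect_eq)
    then have "0 \<le> norm (w x) * k x - w x \<bullet> w x"
      by (metis (no_types, lifting) empty_iff linorder_not_less mem_Collect_eq)
    then have "norm (w x) * norm (w x) \<le> norm (w x) * k x"
      by (simp add: power2_norm_eq_inner[symmetric] power2_eq_square)
    then show ?case
      using nonneg[of x] by (cases "w x = 0") auto
  qed
qed

section \<open>Weak derivatives on the half-line\<close>

text \<open>A quadratic spline rising from 0 to 1 on the unit interval. It is continuously
  differentiable, which is all the smoothness that \<open>test_fun\<close> demands.\<close>

definition ramp :: "real \<Rightarrow> real" where
  "ramp x = 2 * (max 0 x)\<^sup>2 - 4 * (max 0 (x - 1 / 2))\<^sup>2 + 2 * (max 0 (x - 1))\<^sup>2"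

text \<open>The derivative of \<open>ramp\<close>: a hat on the unit interval of height 2 and total
  mass 1.\<close>

definition tent :: "real \<Rightarrow> real" where
  "tent x = 4 * max 0 x - 8 * max 0 (x - 1 / 2) + 4 * max 0 (x - 1)"

lemma has_real_derivative_max_0_squared:
  "((\<lambda>x. (max 0 x)\<^sup>2) has_real_derivative 2 * max 0 x) (at x)" for x :: real
proof (cases x "0 :: real" rule: linorder_cases)
  case less
  have "((\<lambda>x. 0) has_real_derivative 0) (at x)"
    by simp
  then have "((\<lambda>x. (max 0 x)\<^sup>2) has_real_derivative 0) (at x)"
    by (rule has_field_derivative_transform_within_open[of _ _ _ "{..<0}"]) (use less in auto)
  then show ?thesis
    using less by simp
next
  case equal
  have "((\<lambda>h :: real. (max 0 h)\<^sup>2 / h) \<longlongrightarrow> 0) (at 0)"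
    by (rule Lim_null_comparison[where g = "\<lambda>h. \<bar>h\<bar>"])
       (auto simp: max_def power2_eq_square intro!: always_eventually tendsto_rabs_zero tendsto_ident_at)
  then show ?thesis
    using equal by (simp add: DERIV_def)
next
  case greater
  have "((\<lambda>x. x\<^sup>2) has_real_derivative 2 * x) (at x)"
    by (auto intro!: derivative_eq_intros)
  then have "((\<lambda>x. (max 0 x)\<^sup>2) has_real_derivative 2 * x) (at x)"
    by (rule has_field_derivative_transform_within_open[of _ _ _ "{0<..}"]) (use greater in auto)
  then show ?thesis
    using greater by simp
qed

lemma has_real_derivative_ramp: "(ramp has_real_derivative tent x) (at x)"
proof -
  have shift: "((\<lambda>x. (max 0 (x - a))\<^sup>2) has_real_derivative 2 * max 0 (x - a)) (at x)" for a
    using DERIV_shift[of "\<lambda>x. (max 0 x)\<^sup>2" "2 * max 0 (x - a)" x "- a"]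
      has_real_derivative_max_0_squared[of "x - a"]
    by simp
  have "((\<lambda>x. 2 * (max 0 x)\<^sup>2 - 4 * (max 0 (x - 1 / 2))\<^sup>2 + 2 * (max 0 (x - 1))\<^sup>2) has_real_derivative
      2 * (2 * max 0 x) - 4 * (2 * max 0 (x - 1 / 2)) + 2 * (2 * max 0 (x - 1))) (at x)"
    by (intro DERIV_add DERIV_diff DERIV_cmult has_real_derivative_max_0_squared shift)
  then show ?thesis
    by (simp add: ramp_def[abs_def] tent_def)
qed

lemma continuous_on_tent: "continuous_on A tent"
  unfolding tent_def[abs_def] by (intro continuous_intros)

lemma ramp_eq_0: "x \<le> 0 \<Longrightarrow> ramp x = 0"
  by (simp add: ramp_def)

lemma ramp_eq_1: "1 \<le> x \<Longrightarrow> ramp x = 1"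
  by (simp add: ramp_def power2_eq_square algebra_simps)

lemma tent_nonneg: "0 \<le> tent x"
  by (auto simp: tent_def max_def)

lemma tent_eq_0: "x \<notin> {0..1} \<Longrightarrow> tent x = 0"
  by (auto simp: tent_def max_def)

lemma ramp_mono: "x \<le> y \<Longrightarrow> ramp x \<le> ramp y"
  by (rule DERIV_nonneg_imp_nondecreasing) (use has_real_derivative_ramp tent_nonneg in blast)+

lemma ramp_bounds: "0 \<le> ramp x" "ramp x \<le> 1"
  using ramp_mono[of "min x 0" x] ramp_mono[of x "max x 1"]
  by (simp_all add: ramp_eq_0 ramp_eq_1)

lemma has_bochner_integral_tent: "has_bochner_integral lborel tent 1"
proof -
  have "has_bochner_integral lborel (\<lambda>x. tent x * indicator {0..1} x) (ramp 1 - ramp 0)"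
    by (rule has_bochner_integral_FTC_Icc_real)
       (use has_real_derivative_ramp continuous_on_tent[of UNIV] in \<open>auto simp: continuous_on_eq_continuous_at\<close>)
  also have "(\<lambda>x. tent x * indicator {0..1} x) = tent"
    using tent_eq_0 by (auto simp: fun_eq_iff indicator_def)
  finally show ?thesis
    by (simp add: ramp_eq_0 ramp_eq_1)
qed

text \<open>The kernels have mass 1 and are supported between \<open>s + 1 / Suc n\<close> and
  \<open>s + 2 / Suc n\<close>: an approximate identity shrinking to \<open>s\<close> from the
  right. Rescaling turns the integral into an average of \<open>v\<close> with the fixed weight
  \<open>tent\<close>, so that dominated convergence applies.\<close>

lemma tent_approximates_value:
  fixes v :: "real \<Rightarrow> 'a::euclidean_space"
  assumes v: "continuous_on UNIV v"
  shows "(\<lambda>n. LINT x|lborel. (real (Suc n) * tent (real (Suc n) * (x - s) - 1)) *\<^sub>R v x) \<longlonglongrightarrow> v s"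
proof -
  have [measurable]: "v \<in> borel_measurable borel" "tent \<in> borel_measurable borel"
    using v continuous_on_tent by (auto intro: borel_measurable_continuous_onI)
  have eq: "(LINT x|lborel. (real (Suc n) * tent (real (Suc n) * (x - s) - 1)) *\<^sub>R v x) =
      (LINT x|lborel. tent x *\<^sub>R v (s + (x + 1) / real (Suc n)))" for n
  proof -
    let ?m = "real (Suc n)"
    have m: "?m > 0" by simp
    have "(LINT x|lborel. (?m * tent (?m * (x - s) - 1)) *\<^sub>R v x) =
      \<bar>1 / ?m\<bar> *\<^sub>R (LINT x|lborel. (?m * tent (?m * (((s + 1 / ?m) + 1 / ?m * x) - s) - 1)) *\<^sub>R v ((s + 1 / ?m) + 1 / ?m * x))"
      by (rule lborel_integral_real_affine) simp
    also have "(\<lambda>x. (?m * tent (?m * (((s + 1 / ?m) + 1 / ?m * x) - s) - 1)) *\<^sub>R v ((s + 1 / ?m) + 1 / ?m * x)) =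
        (\<lambda>x. ?m *\<^sub>R (tent x *\<^sub>R v (s + (x + 1) / ?m)))"
    proof
      fix x
      have "?m * (((s + 1 / ?m) + 1 / ?m * x) - s) - 1 = x" "(s + 1 / ?m) + 1 / ?m * x = s + (x + 1) / ?m"
        using m by (simp_all add: field_simps del: of_nat_Suc)
      then show "(?m * tent (?m * (((s + 1 / ?m) + 1 / ?m * x) - s) - 1)) *\<^sub>R v ((s + 1 / ?m) + 1 / ?m * x) =
          ?m *\<^sub>R (tent x *\<^sub>R v (s + (x + 1) / ?m))"
        by (metis scaleR_scaleR)
    qed
    also have "\<bar>1 / ?m\<bar> *\<^sub>R (LINT x|lborel. ?m *\<^sub>R (tent x *\<^sub>R v (s + (x + 1) / ?m))) =
        (LINT x|lborel. tent x *\<^sub>R v (s + (x + 1) / ?m))"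
      unfolding Bochner_Integration.integral_scaleR_right scaleR_scaleR[of "\<bar>1 / ?m\<bar>"]
      using m by (simp del: of_nat_Suc)
    finally show ?thesis .
  qed
  \<comment> \<open>Where \<open>tent x\<close> is not 0, the rescaled argument of \<open>v\<close>
    stays in \<open>{s..s + 2}\<close>, so one bound serves for all \<open>n\<close>.\<close>
  obtain B where B: "\<And>x. x \<in> {s..s + 2} \<Longrightarrow> norm (v x) \<le> B"
    using compact_imp_bounded[OF compact_continuous_image[OF continuous_on_subset[OF v] compact_Icc],
        of s "s + 2"]
    unfolding bounded_iff by (metis imageI subset_UNIV)
  have "(\<lambda>n. LINT x|lborel. tent x *\<^sub>R v (s + (x + 1) / real (Suc n))) \<longlonglongrightarrow> (LINT x|lborel. tent x *\<^sub>R v s)"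
  proof (rule integral_dominated_convergence)
    show "integrable lborel (\<lambda>x. tent x * B)"
      using has_bochner_integral_tent by (auto simp: has_bochner_integral_iff)
    show "AE x in lborel. (\<lambda>n. tent x *\<^sub>R v (s + (x + 1) / real (Suc n))) \<longlonglongrightarrow> tent x *\<^sub>R v s"
    proof (intro always_eventually allI tendsto_intros)
      fix x
      have "(\<lambda>n. s + (x + 1) / real (Suc n)) \<longlonglongrightarrow> s + 0"
        by (intro tendsto_intros LIMSEQ_Suc lim_const_over_n)
      then have "(\<lambda>n. s + (x + 1) / real (Suc n)) \<longlonglongrightarrow> s" by simp
      then show "(\<lambda>n. v (s + (x + 1) / real (Suc n))) \<longlonglongrightarrow> v s"
        using v by (intro isCont_tendsto_compose[of s v]) (auto simp: continuous_on_eq_continuous_at)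
    qed
    show "AE x in lborel. norm (tent x *\<^sub>R v (s + (x + 1) / real (Suc n))) \<le> tent x * B" for n
    proof (intro always_eventually allI)
      fix x
      show "norm (tent x *\<^sub>R v (s + (x + 1) / real (Suc n))) \<le> tent x * B"
      proof (cases "x \<in> {0..1}")
        case True
        then have "(x + 1) / real (Suc n) \<le> (x + 1) / 1"
          by (intro divide_left_mono) auto
        then have "norm (v (s + (x + 1) / real (Suc n))) \<le> B"
          using True by (intro B) auto
        then show ?thesis
          using tent_nonneg[of x] by (simp add: mult_left_mono)
      qed (simp add: tent_eq_0)
    qed
  qed measurable
  also have "(LINT x|lborel. tent x *\<^sub>R v s) = v s"
    using has_bochner_integral_scaleR_left[OF has_bochner_integral_tent, of "v s"]
    by (simp add: has_bochner_integral_iff)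
  finally show ?thesis
    by (simp only: eq)
qed

section \<open>The fundamental theorem of calculus for weak derivatives\<close>

text \<open>Test with the smoothed indicators \<open>\<psi> n\<close> of \<open>{s<..t}\<close>.
  Their derivatives are differences of approximate identities at \<open>s\<close> and at
  \<open>t\<close>, so the left side of \<open>weak\<close> tends to \<open>v s - v t\<close>, while
  the right side tends to minus the integral of \<open>w\<close>.\<close>

lemma increment_eq_integral:
  fixes v w :: "real \<Rightarrow> 'a::euclidean_space"
  assumes v: "continuous_on UNIV v"
    and meas [measurable]: "w \<in> borel_measurable borel"
    and w: "\<And>a b. set_integrable lborel {a<..b} w"
    and weak: "\<And>\<psi>. test_fun \<psi> \<Longrightarrow>
      (LINT r|lborel. deriv \<psi> r *\<^sub>R v r) = - (LINT r|lborel. \<psi> r *\<^sub>R w r)"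
    and st: "1 \<le> s" "s \<le> t"
  shows "v t - v s = (LINT x:{s<..t}|lborel. w x)"
proof -
  define \<psi> where "\<psi> n x = ramp (real (Suc n) * (x - s) - 1) - ramp (real (Suc n) * (x - t) - 1)" for n x
  define \<delta> where "\<delta> n a x = real (Suc n) * tent (real (Suc n) * (x - a) - 1)" for n a x
  have [measurable]: "v \<in> borel_measurable borel" "tent \<in> borel_measurable borel"
    using v continuous_on_tent by (auto intro: borel_measurable_continuous_onI)
  have ramp_cont: "continuous_on UNIV ramp"
    using has_real_derivative_ramp DERIV_isCont by (auto simp: continuous_on_eq_continuous_at)
  then have [measurable]: "\<psi> n \<in> borel_measurable borel" for n
    unfolding \<psi>_def[abs_def]
    by (intro borel_measurable_continuous_onI continuous_intros continuous_on_compose2[OF ramp_cont]) auto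
  have deriv: "(\<psi> n has_real_derivative \<delta> n s x - \<delta> n t x) (at x)" for n x
  proof -
    have "((\<lambda>x. ramp (real (Suc n) * (x - a) - 1)) has_real_derivative
        tent (real (Suc n) * (x - a) - 1) * real (Suc n)) (at x)" for a
      by (rule DERIV_chain2[OF has_real_derivative_ramp])
         (auto intro!: derivative_eq_intros simp del: of_nat_Suc)
    then show ?thesis
      unfolding \<psi>_def[abs_def] \<delta>_def by (auto intro!: DERIV_diff simp: mult.commute)
  qed
  have \<delta>_cont: "continuous_on UNIV (\<delta> n a)" for n a
    unfolding \<delta>_def[abs_def]
    by (intro continuous_intros continuous_on_compose2[OF continuous_on_tent[of UNIV]]) auto
  \<comment> \<open>The shift by \<open>- 1\<close> inside \<open>ramp\<close> keeps the support of
    \<open>\<psi> n\<close> to the right of \<open>s\<close> by \<open>1 / Suc n\<close>, hence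
    inside \<open>{1<..}\<close> even if \<open>s = 1\<close>.\<close>
  have \<psi>_0: "\<psi> n x = 0" if "x \<le> s + 1 / real (Suc n) \<or> t + 2 / real (Suc n) \<le> x" for n x
  proof -
    let ?m = "real (Suc n)"
    have m: "0 < ?m" by simp
    from that show ?thesis
    proof
      assume *: "x \<le> s + 1 / ?m"
      then have "?m * (x - s) \<le> 1"
        using m by (simp add: field_simps del: of_nat_Suc)
      moreover have "?m * (x - t) \<le> ?m * (x - s)"
        using m st by (intro mult_left_mono) auto
      ultimately have "?m * (x - s) - 1 \<le> 0" "?m * (x - t) - 1 \<le> 0" by linarith+
      then show ?thesis
        unfolding \<psi>_def by (simp only: ramp_eq_0)
    next
      assume *: "t + 2 / ?m \<le> x"
      then have "2 \<le> ?m * (x - t)"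
        using m by (simp add: field_simps del: of_nat_Suc)
      moreover have "?m * (x - t) \<le> ?m * (x - s)"
        using m st by (intro mult_left_mono) auto
      ultimately have "1 \<le> ?m * (x - s) - 1" "1 \<le> ?m * (x - t) - 1" by linarith+
      then show ?thesis
        unfolding \<psi>_def by (simp only: ramp_eq_1)
    qed
  qed
  have test: "test_fun (\<psi> n)" for n
    unfolding test_fun_def
  proof (intro conjI exI[of _ "{s + 1 / real (Suc n)..t + 2 / real (Suc n)}"])
    show "\<psi> n C1_differentiable_on UNIV"
      unfolding C1_differentiable_on_def
      by (intro exI[of _ "\<lambda>x. \<delta> n s x - \<delta> n t x"] conjI ballI continuous_intros \<delta>_cont)
         (use deriv in \<open>auto simp: has_real_derivative_iff_has_vector_derivative\<close>)
    show "{s + 1 / real (Suc n)..t + 2 / real (Suc n)} \<subseteq> {1<..}"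
    proof
      fix x assume "x \<in> {s + 1 / real (Suc n)..t + 2 / real (Suc n)}"
      moreover have "0 < 1 / real (Suc n)" by simp
      ultimately show "x \<in> {1<..}" using st unfolding atLeastAtMost_iff greaterThan_iff by linarith
    qed
    show "\<forall>r. r \<notin> {s + 1 / real (Suc n)..t + 2 / real (Suc n)} \<longrightarrow> \<psi> n r = 0"
      by (auto intro!: \<psi>_0)
  qed auto
  have \<delta>_int: "integrable lborel (\<lambda>x. \<delta> n a x *\<^sub>R v x)" for n a
  proof -
    let ?I = "{a + 1 / real (Suc n)..a + 2 / real (Suc n)}"
    have "integrable lborel (\<lambda>x. indicator ?I x *\<^sub>R (\<delta> n a x *\<^sub>R v x))"
      by (intro borel_integrable_compact continuous_intros continuous_on_subset[OF v]
          continuous_on_subset[OF \<delta>_cont]) auto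
    also have "(\<lambda>x. indicator ?I x *\<^sub>R (\<delta> n a x *\<^sub>R v x)) = (\<lambda>x. \<delta> n a x *\<^sub>R v x)"
    proof
      fix x
      show "indicator ?I x *\<^sub>R (\<delta> n a x *\<^sub>R v x) = \<delta> n a x *\<^sub>R v x"
      proof (cases "x \<in> ?I")
        case False
        have m: "0 < real (Suc n)" by simp
        have "real (Suc n) * (x - a) - 1 \<notin> {0..1}"
        proof
          assume "real (Suc n) * (x - a) - 1 \<in> {0..1}"
          then have "x \<in> ?I" using m by (simp add: field_simps del: of_nat_Suc)
          with False show False ..
        qed
        then show ?thesis by (simp add: \<delta>_def tent_eq_0)
      qed simp
    qed
    finally show ?thesis .
  qed
  have "(\<lambda>n. LINT r|lborel. deriv (\<psi> n) r *\<^sub>R v r) \<longlonglongrightarrow> v s - v t"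
  proof -
    have "(LINT r|lborel. deriv (\<psi> n) r *\<^sub>R v r) =
        (LINT r|lborel. \<delta> n s r *\<^sub>R v r) - (LINT r|lborel. \<delta> n t r *\<^sub>R v r)" for n
      unfolding DERIV_imp_deriv[OF deriv] scaleR_diff_left
      by (rule Bochner_Integration.integral_diff; rule \<delta>_int)
    then show ?thesis
      using tendsto_diff[OF tent_approximates_value[OF v, of s] tent_approximates_value[OF v, of t]]
      by (simp add: \<delta>_def del: of_nat_Suc)
  qed
  then have lim1: "(\<lambda>n. LINT r|lborel. \<psi> n r *\<^sub>R w r) \<longlonglongrightarrow> v t - v s"
    unfolding weak[OF test] by (drule_tac tendsto_minus) simp
  have lim2: "(\<lambda>n. LINT r|lborel. \<psi> n r *\<^sub>R w r) \<longlonglongrightarrow> (LINT r|lborel. indicator {s<..t} r *\<^sub>R w r)"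
  proof (rule integral_dominated_convergence)
    \<comment> \<open>All \<open>\<psi> n\<close> are bounded by 1 and vanish outside
      \<open>{s<..t + 2}\<close>, since \<open>2 / Suc n\<close> is at most 2.\<close>
    show "integrable lborel (\<lambda>x. norm (indicator {s<..t + 2} x *\<^sub>R w x))"
      using w[of s "t + 2"] unfolding set_integrable_def by (rule integrable_norm)
    show "AE x in lborel. norm (\<psi> n x *\<^sub>R w x) \<le> norm (indicator {s<..t + 2} x *\<^sub>R w x)" for n
    proof (intro always_eventually allI)
      fix x
      show "norm (\<psi> n x *\<^sub>R w x) \<le> norm (indicator {s<..t + 2} x *\<^sub>R w x)"
      proof (cases "x \<in> {s<..t + 2}")
        case True
        have "\<bar>\<psi> n x\<bar> \<le> 1"
          using ramp_bounds[of "real (Suc n) * (x - s) - 1"] ramp_bounds[of "real (Suc n) * (x - t) - 1"]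
          unfolding \<psi>_def by linarith
        then show ?thesis
          using True by (simp add: mult_left_le_one_le)
      next
        case False
        have "0 < 1 / real (Suc n)" by simp
        moreover have "2 / real (Suc n) \<le> 2 / 1" by (intro divide_left_mono) auto
        moreover have "x \<le> s \<or> t + 2 < x" using False by auto
        ultimately have "x \<le> s + 1 / real (Suc n) \<or> t + 2 / real (Suc n) \<le> x" by linarith
        then have "\<psi> n x = 0" by (rule \<psi>_0)
        then show ?thesis by simp
      qed
    qed
    show "AE x in lborel. (\<lambda>n. \<psi> n x *\<^sub>R w x) \<longlonglongrightarrow> indicator {s<..t} x *\<^sub>R w x"
    proof (intro always_eventually allI tendsto_intros)
      fix x
      \<comment> \<open>At \<open>x = a\<close> the argument of \<open>ramp\<close> is
        \<open>- 1\<close> and the limit is 0, which makes the limiting interval open at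
        \<open>s\<close> and closed at \<open>t\<close>.\<close>
      have lim: "(\<lambda>n. ramp (real (Suc n) * (x - a) - 1)) \<longlonglongrightarrow> (if a < x then 1 else 0)" for a
      proof (cases "a < x")
        case True
        obtain N where N: "2 < real N * (x - a)"
          using reals_Archimedean3[of "x - a"] True by auto
        have "\<forall>\<^sub>F n in sequentially. ramp (real (Suc n) * (x - a) - 1) = 1"
        proof (rule eventually_sequentiallyI[of N])
          fix n assume "N \<le> n"
          then have "real N * (x - a) \<le> real (Suc n) * (x - a)"
            using True by (intro mult_right_mono) auto
          then show "ramp (real (Suc n) * (x - a) - 1) = 1"
            using N by (intro ramp_eq_1) linarith
        qed
        then show ?thesis
          using True by (simp add: tendsto_eventually)
      next
        case False
        have "ramp (real (Suc n) * (x - a) - 1) = 0" for n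
        proof (rule ramp_eq_0)
          have "real (Suc n) * (x - a) \<le> 0"
            using False by (intro mult_nonneg_nonpos) auto
          then show "real (Suc n) * (x - a) - 1 \<le> 0" by linarith
        qed
        then show ?thesis using False by simp
      qed
      show "(\<lambda>n. \<psi> n x) \<longlonglongrightarrow> indicator {s<..t} x"
        unfolding \<psi>_def using tendsto_diff[OF lim[of s] lim[of t]] st
        by (auto simp: indicator_def split: if_splits)
    qed
  qed measurable
  show ?thesis
    using LIMSEQ_unique[OF lim1 lim2] by (simp add: set_lebesgue_integral_def)
qed

lemma test_fun_deriv_eq_0:
  assumes "\<And>r. r \<notin> K \<Longrightarrow> \<psi> r = 0" "compact K" "r \<notin> K"
  shows "deriv \<psi> r = (0 :: real)"
proof -
  have "((\<lambda>x. 0) has_real_derivative 0) (at r)"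
    by simp
  then have "(\<psi> has_real_derivative 0) (at r)"
    by (rule has_field_derivative_transform_within_open[of _ _ _ "- K"])
       (use assms in \<open>auto simp: open_Compl compact_imp_closed\<close>)
  then show ?thesis
    by (rule DERIV_imp_deriv)
qed

lemma test_fun_has_deriv:
  assumes "test_fun \<psi>"
  shows "(\<psi> has_real_derivative deriv \<psi> r) (at r)" "continuous_on UNIV (deriv \<psi>)"
proof -
  obtain \<delta> where \<delta>: "\<And>x. (\<psi> has_real_derivative \<delta> x) (at x)" "continuous_on UNIV \<delta>"
    using assms unfolding test_fun_def C1_differentiable_on_def
    by (auto simp: has_real_derivative_iff_has_vector_derivative)
  moreover have "deriv \<psi> = \<delta>"
    using \<delta>(1) DERIV_imp_deriv by blast
  ultimately show "(\<psi> has_real_derivative deriv \<psi> r) (at r)" "continuous_on UNIV (deriv \<psi>)"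
    by auto
qed

text \<open>Both iterated integrals of \<open>\<psi>' x *\<^sub>R w y\<close> over the triangle \<open>a < y \<le> x \<le> b\<close> are evaluated.\<close>

lemma integral_test_fun_by_parts:
  fixes v w :: "real \<Rightarrow> 'a::euclidean_space"
  assumes v: "continuous_on UNIV v"
    and meas [measurable]: "w \<in> borel_measurable borel"
    and w: "\<And>a b. set_integrable lborel {a<..b} w"
    and inc: "\<And>a b. a \<le> b \<Longrightarrow> v b - v a = (LINT x:{a<..b}|lborel. w x)"
    and test: "test_fun \<psi>"
  shows "(LINT r|lborel. deriv \<psi> r *\<^sub>R v r) = - (LINT r|lborel. \<psi> r *\<^sub>R w r)"
proof -
  let ?d = "deriv \<psi>"
  note d = test_fun_has_deriv[OF test]
  have [measurable]: "?d \<in> borel_measurable borel"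
    using d(2) by (rule borel_measurable_continuous_onI)
  obtain K where K: "compact K" "\<And>r. r \<notin> K \<Longrightarrow> \<psi> r = 0"
    using test by (auto simp: test_fun_def)
  obtain c where c: "0 < c" "\<And>x. x \<in> K \<Longrightarrow> norm x \<le> c"
    using compact_imp_bounded[OF K(1)] by (auto simp: bounded_pos)
  \<comment> \<open>Enlarging by 1 puts both end points outside the support, so that \<psi> and its
    derivative vanish at and beyond them.\<close>
  define a b where "a = - c - 1" and "b = c + 1"
  have outside: "\<psi> x = 0" "?d x = 0" if "x \<le> a \<or> b \<le> x" for x
    using c that K test_fun_deriv_eq_0[of K \<psi> x] by (force simp: a_def b_def)+
  have ab: "a < b"
    using c(1) by (simp add: a_def b_def)
  obtain B where B: "\<And>x. x \<in> {a..b} \<Longrightarrow> norm (?d x) \<le> B"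
    using compact_imp_bounded[OF compact_continuous_image[OF continuous_on_subset[OF d(2)] compact_Icc], of a b]
    unfolding bounded_iff by (metis imageI subset_UNIV)
  have B0: "0 \<le> B"
    using B[of a] ab by (auto intro: order_trans[OF norm_ge_zero])
  define f where "f x y = (indicator {a<..b} y * indicator {y..b} x * ?d x) *\<^sub>R w y" for x y
  have f_alt: "f x y = (if a < y \<and> y \<le> b \<and> y \<le> x \<and> x \<le> b then ?d x *\<^sub>R w y else 0)" for x y
    by (auto simp: f_def indicator_def)
  \<comment> \<open>For Fubini: the product of the bound \<open>B\<close> on the derivative and the
    norm of \<open>w\<close> is integrable on the square and dominates \<open>f\<close> on the
    triangle.\<close>
  have "integrable (lborel \<Otimes>\<^sub>M lborel) (\<lambda>(x, y). (B * indicator {a<..b} x) * norm (indicator {a<..b} y *\<^sub>R w y))"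
  proof (rule lborel_pair.Fubini_integrable)
    have wi: "integrable lborel (\<lambda>y. norm (indicator {a<..b} y *\<^sub>R w y))"
      using w[of a b] unfolding set_integrable_def by (rule integrable_norm)
    show "integrable lborel (\<lambda>x. LINT y|lborel. norm (case (x, y) of
        (x, y) \<Rightarrow> (B * indicator {a<..b} x) * norm (indicator {a<..b} y *\<^sub>R w y)))"
      using ab B0 by (simp add: abs_mult)
    show "AE x in lborel. integrable lborel (\<lambda>y. case (x, y) of
        (x, y) \<Rightarrow> (B * indicator {a<..b} x) * norm (indicator {a<..b} y *\<^sub>R w y))"
      unfolding prod.case by (intro always_eventually allI integrable_mult_right wi)
  qed measurable
  then have "integrable (lborel \<Otimes>\<^sub>M lborel) (case_prod f)"
  proof (rule Bochner_Integration.integrable_bound)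
    show "AE p in lborel \<Otimes>\<^sub>M lborel. norm (case_prod f p) \<le>
        norm (case p of (x, y) \<Rightarrow> (B * indicator {a<..b} x) * norm (indicator {a<..b} y *\<^sub>R w y))"
      using B B0 by (intro always_eventually allI)
        (auto simp: f_alt indicator_def abs_mult intro!: mult_right_mono)
  qed (simp add: f_alt case_prod_beta')
  then have "(LINT y|lborel. LINT x|lborel. f x y) = (LINT x|lborel. LINT y|lborel. f x y)"
    by (rule lborel_pair.Fubini_integral)
  also have "(\<lambda>x. LINT y|lborel. f x y) = (\<lambda>x. ?d x *\<^sub>R v x - ?d x *\<^sub>R v a)"
  proof
    fix x
    consider "x \<le> a \<or> b \<le> x" | "a < x" "x < b" by linarith
    then show "(LINT y|lborel. f x y) = ?d x *\<^sub>R v x - ?d x *\<^sub>R v a"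
    proof cases
      case 1
      then show ?thesis by (simp add: f_def outside)
    next
      case 2
      have "f x = (\<lambda>y. ?d x *\<^sub>R (indicator {a<..x} y *\<^sub>R w y))"
        using 2 by (auto simp: fun_eq_iff f_alt indicator_def)
      then show ?thesis
        using inc[of a x] 2 by (simp add: set_lebesgue_integral_def scaleR_diff_right[symmetric] del: scaleR_scaleR)
    qed
  qed
  also have "(\<lambda>y. LINT x|lborel. f x y) = (\<lambda>y. - (\<psi> y *\<^sub>R w y))"
  proof
    fix y
    consider "y \<le> a \<or> b \<le> y" | "a < y" "y < b" by linarith
    then show "(LINT x|lborel. f x y) = - (\<psi> y *\<^sub>R w y)"
    proof cases
      case 1
      then have "f x y = 0" for x
        using outside[of x] by (auto simp: f_alt)
      with 1 show ?thesis by (simp add: outside)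
    next
      case 2
      have "has_bochner_integral lborel (\<lambda>x. ?d x * indicator {y..b} x) (\<psi> b - \<psi> y)"
        using d 2 by (intro has_bochner_integral_FTC_Icc_real) (auto simp: continuous_on_eq_continuous_at)
      then have "has_bochner_integral lborel (\<lambda>x. (?d x * indicator {y..b} x) *\<^sub>R w y) ((\<psi> b - \<psi> y) *\<^sub>R w y)"
        by (intro has_bochner_integral_scaleR_left)
      moreover have "(\<lambda>x. f x y) = (\<lambda>x. (?d x * indicator {y..b} x) *\<^sub>R w y)"
        using 2 by (auto simp: f_def)
      ultimately show ?thesis
        by (simp add: has_bochner_integral_iff outside)
    qed
  qed
  \<comment> \<open>The term with \<open>v a\<close> integrates to a multiple of
    \<open>\<psi> b - \<psi> a\<close>, which is 0.\<close>
  also have "(LINT x|lborel. ?d x *\<^sub>R v x - ?d x *\<^sub>R v a) = (LINT x|lborel. ?d x *\<^sub>R v x)"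
  proof -
    have supp: "indicator {a..b} x *\<^sub>R (?d x *\<^sub>R z) = ?d x *\<^sub>R z" for x and z :: 'a
      by (cases "x \<le> a \<or> b \<le> x") (auto simp: outside indicator_def)
    have "integrable lborel (\<lambda>x. indicator {a..b} x *\<^sub>R (?d x *\<^sub>R v x))"
      by (intro borel_integrable_compact continuous_intros continuous_on_subset[OF v]
          continuous_on_subset[OF d(2)]) auto
    then have "integrable lborel (\<lambda>x. ?d x *\<^sub>R v x)"
      by (simp only: supp)
    moreover have "has_bochner_integral lborel (\<lambda>x. ?d x *\<^sub>R v a) 0"
    proof -
      have "has_bochner_integral lborel (\<lambda>x. ?d x * indicator {a..b} x) (\<psi> b - \<psi> a)"
        using d ab by (intro has_bochner_integral_FTC_Icc_real) (auto simp: continuous_on_eq_continuous_at)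
      then have "has_bochner_integral lborel (\<lambda>x. (?d x * indicator {a..b} x) *\<^sub>R v a) ((\<psi> b - \<psi> a) *\<^sub>R v a)"
        by (intro has_bochner_integral_scaleR_left)
      moreover have "(?d x * indicator {a..b} x) *\<^sub>R v a = ?d x *\<^sub>R v a" for x
        by (cases "x \<le> a \<or> b \<le> x") (auto simp: outside indicator_def)
      ultimately show ?thesis
        by (simp add: outside)
    qed
    ultimately show ?thesis
      by (subst Bochner_Integration.integral_diff) (auto simp: has_bochner_integral_iff)
  qed
  finally show ?thesis
    by simp
qed

section \<open>From Lebesgue measure on the half-line to Borel measure on the line\<close>

lemma integral_lebesgue_on_eq_lborel:
  fixes u v :: "real \<Rightarrow> 'a::euclidean_space" and c :: "real \<Rightarrow> real"
  assumes meas [measurable]: "c \<in> borel_measurable borel" "v \<in> borel_measurable borel"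
    and u [measurable]: "u \<in> borel_measurable (lebesgue_on {1<..})"
    and ae: "AE r in lebesgue_on {1<..}. u r = v r"
    and c: "\<And>r. r \<le> 1 \<Longrightarrow> c r = 0"
  shows "(LINT r|lebesgue_on {1<..}. c r *\<^sub>R u r) = (LINT r|lborel. c r *\<^sub>R v r)"
proof -
  have m [measurable]: "c \<in> borel_measurable (lebesgue_on {1<..})" "v \<in> borel_measurable (lebesgue_on {1<..})"
    using meas by (auto intro!: measurable_restrict_space1 measurable_completion)
  have "(LINT r|lebesgue_on {1<..}. c r *\<^sub>R u r) = (LINT r|lebesgue_on {1<..}. c r *\<^sub>R v r)"
    using ae by (intro integral_cong_AE) auto
  also have "\<dots> = (LINT r|lebesgue. indicator {1<..} r *\<^sub>R (c r *\<^sub>R v r))"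
    by (intro integral_restrict_space) auto
  also have "\<dots> = (LINT r|lebesgue. c r *\<^sub>R v r)"
    by (intro Bochner_Integration.integral_cong) (use c linorder_not_less in \<open>auto simp: indicator_def\<close>)
  also have "\<dots> = (LINT r|lborel. c r *\<^sub>R v r)"
    by (intro integral_completion) measurable
  finally show ?thesis .
qed

lemma borel_version:
  fixes f :: "real \<Rightarrow> 'a::euclidean_space"
  assumes "f \<in> borel_measurable lebesgue"
  shows "\<exists>g\<in>borel_measurable borel. AE x in lborel. f x = g x"
proof -
  have "\<exists>g. g \<in> borel_measurable borel \<and> (AE x in lborel. f x \<bullet> i = g x)" for i
    using completion_ex_borel_measurable_real[of "\<lambda>x. f x \<bullet> i" lborel] assms by auto
  then have "\<exists>g. \<forall>i. g i \<in> borel_measurable borel \<and> (AE x in lborel. f x \<bullet> i = g i x)"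
    by (intro choice allI)
  then obtain g where [measurable]: "\<And>i. g i \<in> borel_measurable borel"
    and ae: "\<And>i. AE x in lborel. f x \<bullet> i = g i x"
    by blast
  have "AE x in lborel. \<forall>i\<in>Basis. f x \<bullet> i = g i x"
    using ae by (intro AE_finite_allI) auto
  then have "AE x in lborel. f x = (\<Sum>i\<in>Basis. g i x *\<^sub>R i)"
    by eventually_elim (metis (mono_tags, lifting) euclidean_representation sum.cong)
  then show ?thesis
    by (intro bexI[of _ "\<lambda>x. \<Sum>i\<in>Basis. g i x *\<^sub>R i"]) measurable
qed

lemma AE_lebesgue_on_Ioi_iff:
  "(AE r in lebesgue_on {1<..}. P r) \<longleftrightarrow> (AE r in lborel. 1 < r \<longrightarrow> P (r :: real))"
  by (subst AE_restrict_space_iff) (auto simp: AE_completion_iff)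

lemma integrable_lebesgue_on_Ioi_iff:
  fixes w :: "real \<Rightarrow> real"
  assumes [measurable]: "w \<in> borel_measurable borel" and "\<And>r. r \<le> 1 \<Longrightarrow> w r = 0"
  shows "integrable (lebesgue_on {1<..}) w \<longleftrightarrow> integrable lborel w"
proof -
  have "(\<lambda>x. indicator {1<..} x *\<^sub>R w x) = w"
    using assms(2) by (force simp: indicator_def)
  then show ?thesis
    by (subst integrable_restrict_space) (auto simp: integrable_completion)
qed

text \<open>The results on densities ask for Borel functions on the whole line that are integrable
  over bounded intervals. Extension by 0 keeps the square integrable, and
  \<open>norm (g r) \<le> 1 + norm (g r) ^ 2\<close> gives local integrability.\<close>

lemma L2_borel_version:
  fixes w :: "real \<Rightarrow> 'a::euclidean_space"
  assumes "L2 w"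
  shows "\<exists>g\<in>borel_measurable borel. (\<forall>r\<le>1. g r = 0) \<and> (AE r in lebesgue_on {1<..}. w r = g r) \<and>
    integrable lborel (\<lambda>r. norm (g r) ^ 2) \<and> (\<forall>a b. set_integrable lborel {a<..b} g)"
proof -
  have w [measurable]: "w \<in> borel_measurable (lebesgue_on {1<..})"
    and int: "integrable (lebesgue_on {1<..}) (\<lambda>r. norm (w r) ^ 2)"
    using assms by (auto simp: L2_def)
  have "(\<lambda>r. indicator {1<..} r *\<^sub>R w r) \<in> borel_measurable lebesgue"
    using w by (subst (asm) borel_measurable_restrict_space_iff) auto
  then obtain g' where g' [measurable]: "g' \<in> borel_measurable borel"
    and ae': "AE r in lborel. indicator {1<..} r *\<^sub>R w r = g' r"
    using borel_version by blast
  define g where "g r = indicator {1<..} r *\<^sub>R g' r" for r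
  have g [measurable]: "g \<in> borel_measurable borel"
    unfolding g_def[abs_def] by measurable
  have g0: "g r = 0" if "r \<le> 1" for r
    using that by (simp add: g_def)
  have ae: "AE r in lebesgue_on {1<..}. w r = g r"
    unfolding AE_lebesgue_on_Ioi_iff using ae' by eventually_elim (auto simp: g_def)
  have "(\<lambda>r. norm (g r) ^ 2) \<in> borel_measurable (lebesgue_on {1<..})"
    by (intro measurable_restrict_space1 measurable_completion) measurable
  then have "integrable (lebesgue_on {1<..}) (\<lambda>r. norm (g r) ^ 2)"
    using int ae by (subst integrable_cong_AE[where g = "\<lambda>r. norm (w r) ^ 2"]) auto
  then have g2: "integrable lborel (\<lambda>r. norm (g r) ^ 2)"
    by (subst (asm) integrable_lebesgue_on_Ioi_iff) (auto simp: g0)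
  moreover have "set_integrable lborel {a<..b} g" for a b
  proof -
    have "integrable lborel (\<lambda>r. indicator {a<..b} r + norm (g r) ^ 2)"
      using g2 by (cases "a \<le> b") auto
    then show ?thesis
      unfolding set_integrable_def
    proof (rule Bochner_Integration.integrable_bound)
      have "norm (g r) \<le> 1 + norm (g r) ^ 2" for r
        using zero_le_power2[of "norm (g r) - 1"] zero_le_power2[of "norm (g r)"]
        unfolding power2_diff power_one mult_1_right by linarith
      then show "AE r in lborel. norm (indicator {a<..b} r *\<^sub>R g r) \<le> norm (indicator {a<..b} r + norm (g r) ^ 2)"
        by (intro always_eventually allI) (auto simp: indicator_def)
    qed measurable
  qed
  ultimately show ?thesis
    using g g0 ae by (intro bexI[of _ g]) auto
qed

section \<open>Weak derivatives as densities of increments\<close>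

text \<open>Composition with \<open>max 1\<close> extends \<open>v\<close> to the left by the
  constant \<open>v 1\<close>, and \<open>g\<close> is 0 there. Both sides then see only the part of
  \<open>{a<..b}\<close> beyond 1, and the identity takes the form expected by the lemmas on the
  whole line.\<close>

lemma increment_eq_integral_of_weak_derivative:
  fixes u v w g :: "real \<Rightarrow> 'a::euclidean_space"
  assumes v: "continuous_on {1..} v" and u: "u \<in> borel_measurable (lebesgue_on {1<..})"
    and uv: "AE r in lebesgue_on {1<..}. u r = v r"
    and w: "w \<in> borel_measurable (lebesgue_on {1<..})" and weak: "weak_derivative u w"
    and g: "g \<in> borel_measurable borel" "\<And>r. r \<le> 1 \<Longrightarrow> g r = 0"
      "AE r in lebesgue_on {1<..}. w r = g r" "\<And>a b. set_integrable lborel {a<..b} g"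
    and ab: "a \<le> b"
  shows "v (max 1 b) - v (max 1 a) = (LINT r:{a<..b}|lborel. g r)"
proof -
  let ?v = "\<lambda>r. v (max 1 r)"
  have v': "continuous_on UNIV ?v"
    by (intro continuous_on_compose2[OF v] continuous_intros) auto
  have "?v (max 1 b) - ?v (max 1 a) = (LINT r:{max 1 a<..max 1 b}|lborel. g r)"
  proof (rule increment_eq_integral[OF v' g(1) g(4)])
    fix \<psi> assume \<psi>: "test_fun \<psi>"
    then obtain K where K: "compact K" "K \<subseteq> {1<..}" "\<And>r. r \<notin> K \<Longrightarrow> \<psi> r = 0"
      by (auto simp: test_fun_def)
    have 0: "\<psi> r = 0" "deriv \<psi> r = 0" if "r \<le> 1" for r
      using K that test_fun_deriv_eq_0[of K \<psi> r] by force+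
    have "continuous_on UNIV \<psi>"
      using test_fun_has_deriv(1)[OF \<psi>] DERIV_isCont by (auto simp: continuous_on_eq_continuous_at)
    then have m: "\<psi> \<in> borel_measurable borel" "deriv \<psi> \<in> borel_measurable borel" "?v \<in> borel_measurable borel"
      using v' test_fun_has_deriv(2)[OF \<psi>] by (auto intro: borel_measurable_continuous_onI)
    have uv': "AE r in lebesgue_on {1<..}. u r = ?v r"
      using uv unfolding AE_lebesgue_on_Ioi_iff by eventually_elim (auto simp: max_def)
    show "(LINT r|lborel. deriv \<psi> r *\<^sub>R ?v r) = - (LINT r|lborel. \<psi> r *\<^sub>R g r)"
      using weak \<psi> integral_lebesgue_on_eq_lborel[OF m(2,3) u uv' 0(2)]
        integral_lebesgue_on_eq_lborel[OF m(1) g(1) w g(3) 0(1)]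
      by (simp add: weak_derivative_def)
  qed (use ab in auto)
  also have "\<dots> = (LINT r:{a<..b}|lborel. g r)"
    unfolding set_lebesgue_integral_def
  proof (intro Bochner_Integration.integral_cong refl)
    fix x
    show "indicator {max 1 a<..max 1 b} x *\<^sub>R g x = indicator {a<..b} x *\<^sub>R g x"
      by (cases "x \<le> 1") (auto simp: g(2) indicator_def)
  qed
  finally show ?thesis
    by simp
qed

text \<open>The converse, by integration by parts; test functions vanish up to 1, so passing to the
  half-line loses nothing.\<close>

lemma weak_derivative_of_increments:
  fixes v g :: "real \<Rightarrow> 'a::euclidean_space"
  assumes v: "continuous_on UNIV v" and g: "g \<in> borel_measurable borel" "\<And>a b. set_integrable lborel {a<..b} g"
    and inc: "\<And>a b. a \<le> b \<Longrightarrow> v b - v a = (LINT r:{a<..b}|lborel. g r)"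
  shows "weak_derivative v g"
  unfolding weak_derivative_def
proof (intro allI impI)
  fix \<psi> assume \<psi>: "test_fun \<psi>"
  then obtain K where K: "compact K" "K \<subseteq> {1<..}" "\<And>r. r \<notin> K \<Longrightarrow> \<psi> r = 0"
    by (auto simp: test_fun_def)
  have 0: "\<psi> r = 0" "deriv \<psi> r = 0" if "r \<le> 1" for r
    using K that test_fun_deriv_eq_0[of K \<psi> r] by force+
  have "continuous_on UNIV \<psi>"
    using test_fun_has_deriv(1)[OF \<psi>] DERIV_isCont by (auto simp: continuous_on_eq_continuous_at)
  then have m: "\<psi> \<in> borel_measurable borel" "deriv \<psi> \<in> borel_measurable borel" "v \<in> borel_measurable borel"
    using v test_fun_has_deriv(2)[OF \<psi>] by (auto intro: borel_measurable_continuous_onI)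
  have m': "v \<in> borel_measurable (lebesgue_on {1<..})" "g \<in> borel_measurable (lebesgue_on {1<..})"
    using m g by (auto intro!: measurable_restrict_space1 measurable_completion)
  show "(LINT r|lebesgue_on {1<..}. deriv \<psi> r *\<^sub>R v r) = - (LINT r|lebesgue_on {1<..}. \<psi> r *\<^sub>R g r)"
    using integral_test_fun_by_parts[OF v g inc \<psi>] integral_lebesgue_on_eq_lborel[OF m(2,3) m'(1) _ 0(2)]
        integral_lebesgue_on_eq_lborel[OF m(1) g(1) m'(2) _ 0(1)] by simp
qed

text \<open>Increments of \<open>p\<close> are bounded by integrals of \<open>norm (g r)\<close> for
  a Borel version \<open>g\<close> of \<open>w\<close>, so \<open>p\<close> has a density, which is
  dominated by \<open>g\<close> and therefore in \<open>L2\<close>. The second claim concerns every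
  weak derivative of \<open>p\<close> in \<open>L2\<close>, because \<open>wderiv\<close> selects an
  unspecified one.\<close>

lemma weak_derivative_dominated:
  fixes u v w :: "real \<Rightarrow> 'a::euclidean_space" and p :: "real \<Rightarrow> 'b::euclidean_space"
  assumes v: "continuous_on {1..} v" and u: "u \<in> borel_measurable (lebesgue_on {1<..})"
    and uv: "AE r in lebesgue_on {1<..}. u r = v r"
    and w: "L2 w" "weak_derivative u w"
    and p: "continuous_on {1..} p"
    and le: "\<And>s t. 1 \<le> s \<Longrightarrow> s \<le> t \<Longrightarrow> norm (p t - p s) \<le> norm (v t - v s)"
  shows "\<exists>q. L2 q \<and> weak_derivative p q"
    and "\<And>q. L2 q \<Longrightarrow> weak_derivative p q \<Longrightarrow> AE r in lebesgue_on {1<..}. norm (q r) \<le> norm (w r)"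
proof -
  obtain g where g: "g \<in> borel_measurable borel" "\<And>r. r \<le> 1 \<Longrightarrow> g r = 0"
      "AE r in lebesgue_on {1<..}. w r = g r"
      "integrable lborel (\<lambda>r. norm (g r) ^ 2)" "\<And>a b. set_integrable lborel {a<..b} g"
    using L2_borel_version[OF w(1)] by blast
  note [measurable] = g(1)
  have ng: "set_integrable lborel {a<..b} (\<lambda>r. norm (g r))" for a b
    by (rule set_integrable_norm[OF g(5)])
  let ?p = "\<lambda>r. p (max 1 r)"
  have p': "continuous_on UNIV ?p"
    by (intro continuous_on_compose2[OF p] continuous_intros) auto
  have le': "norm (?p b - ?p a) \<le> (LINT r:{a<..b}|lborel. norm (g r))" if "a \<le> b" for a b
  proof -
    have "norm (?p b - ?p a) \<le> norm (v (max 1 b) - v (max 1 a))"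
      using that by (intro le) auto
    also have "\<dots> = norm (LINT r:{a<..b}|lborel. g r)"
      using w increment_eq_integral_of_weak_derivative[OF v u uv _ w(2) g(1-3,5) that]
      by (simp add: L2_def)
    also have "\<dots> \<le> (LINT r:{a<..b}|lborel. norm (g r))"
      by (rule set_integral_norm_bound[OF g(5)])
    finally show ?thesis .
  qed
  \<comment> \<open>Serves both for the Borel version of a given weak derivative and for the density
    constructed at the end.\<close>
  have dom: "AE r in lborel. norm (q r) \<le> norm (g r)"
    if "q \<in> borel_measurable borel" "\<And>a b. set_integrable lborel {a<..b} q"
      "\<And>a b. a \<le> b \<Longrightarrow> ?p b - ?p a = (LINT r:{a<..b}|lborel. q r)" for q
    using that le' by (intro AE_norm_le_if_integrals_le ng) auto
  show "AE r in lebesgue_on {1<..}. norm (q r) \<le> norm (w r)" if q: "L2 q" "weak_derivative p q" for q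
  proof -
    obtain h where h: "h \<in> borel_measurable borel" "\<And>r. r \<le> 1 \<Longrightarrow> h r = 0"
        "AE r in lebesgue_on {1<..}. q r = h r" "integrable lborel (\<lambda>r. norm (h r) ^ 2)"
        "\<And>a b. set_integrable lborel {a<..b} h"
      using L2_borel_version[OF q(1)] by blast
    have pm: "p \<in> borel_measurable (lebesgue_on {1<..})"
      by (rule continuous_imp_measurable_on_sets_lebesgue[OF continuous_on_subset[OF p]]) auto
    have "AE r in lborel. norm (h r) \<le> norm (g r)"
    proof (rule dom[OF h(1,5)])
      show "?p b - ?p a = (LINT r:{a<..b}|lborel. h r)" if "a \<le> b" for a b
        using q(1) increment_eq_integral_of_weak_derivative[OF p pm _ _ q(2) h(1-3,5) that]
        by (simp add: L2_def)
    qed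
    then show ?thesis
      using h(3) g(3) unfolding AE_lebesgue_on_Ioi_iff by eventually_elim auto
  qed
  obtain q where q [measurable]: "q \<in> borel_measurable borel" and qi: "\<And>a b. set_integrable lborel {a<..b} q"
    and qp: "\<And>a b. a \<le> b \<Longrightarrow> ?p b - ?p a = (LINT r:{a<..b}|lborel. q r)"
    using exists_density[OF _ _ ng p' le'] by auto
  have "weak_derivative ?p q"
    by (rule weak_derivative_of_increments[OF p' q qi qp])
  moreover have "(LINT r|lebesgue_on {1<..}. deriv \<psi> r *\<^sub>R ?p r) = (LINT r|lebesgue_on {1<..}. deriv \<psi> r *\<^sub>R p r)" for \<psi>
    by (intro Bochner_Integration.integral_cong) auto
  ultimately have "weak_derivative p q"
    by (simp add: weak_derivative_def)
  moreover have "L2 q"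
    unfolding L2_def
  proof
    show "q \<in> borel_measurable (lebesgue_on {1<..})"
      by (intro measurable_restrict_space1 measurable_completion) simp
    have "integrable lborel (\<lambda>r. norm (q r) ^ 2)"
    proof (rule Bochner_Integration.integrable_bound[OF g(4)])
      have "AE r in lborel. norm (q r) \<le> norm (g r)"
        by (rule dom[OF q qi]) (rule qp)
      then show "AE r in lborel. norm (norm (q r) ^ 2) \<le> norm (norm (g r) ^ 2)"
        by eventually_elim (simp add: power_mono)
    qed measurable
    then have "integrable lebesgue (\<lambda>r. norm (q r) ^ 2)"
      by (subst integrable_completion) auto
    then show "integrable (lebesgue_on {1<..}) (\<lambda>r. norm (q r) ^ 2)"
      by (subst integrable_restrict_space, simp) (rule integrable_mult_indicator, auto)
  qed
  ultimately show "\<exists>q. L2 q \<and> weak_derivative p q"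
    by blast
qed

section \<open>Competitors by Lipschitz maps\<close>

lemma weak_derivative_cong_AE:
  fixes u v w :: "real \<Rightarrow> 'a::euclidean_space"
  assumes u: "u \<in> borel_measurable (lebesgue_on {1<..})" and v: "v \<in> borel_measurable (lebesgue_on {1<..})"
    and uv: "AE r in lebesgue_on {1<..}. u r = v r" and w: "weak_derivative u w"
  shows "weak_derivative v w"
  unfolding weak_derivative_def
proof (intro allI impI)
  fix \<psi> assume \<psi>: "test_fun \<psi>"
  have m: "deriv \<psi> \<in> borel_measurable (lebesgue_on {1<..})"
    by (rule continuous_imp_measurable_on_sets_lebesgue[OF continuous_on_subset[OF test_fun_has_deriv(2)[OF \<psi>]]]) auto
  have "(LINT r|lebesgue_on {1<..}. deriv \<psi> r *\<^sub>R v r) = (LINT r|lebesgue_on {1<..}. deriv \<psi> r *\<^sub>R u r)"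
    using uv m u v by (intro integral_cong_AE) auto
  then show "(LINT r|lebesgue_on {1<..}. deriv \<psi> r *\<^sub>R v r) = - (LINT r|lebesgue_on {1<..}. \<psi> r *\<^sub>R w r)"
    using w \<psi> by (simp add: weak_derivative_def)
qed

text \<open>The points of \<open>{1<..}\<close> where \<open>v\<close> leaves \<open>A\<close> form
  an open null set, which is empty; the end point 1 follows by closure.\<close>

lemma continuous_AE_in_closed:
  fixes v :: "real \<Rightarrow> 'a::euclidean_space"
  assumes v: "continuous_on {1..} v" and A: "closed A" and ae: "AE r in lebesgue_on {1<..}. v r \<in> A"
    and r: "1 \<le> r"
  shows "v r \<in> A"
proof -
  let ?U = "{1<..} \<inter> v -` (- A)"
  have U: "open ?U"
    using A by (intro continuous_open_preimage continuous_on_subset[OF v]) auto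
  have "AE r in lborel. r \<notin> ?U"
    using ae unfolding AE_lebesgue_on_Ioi_iff by eventually_elim auto
  then have "?U \<in> null_sets lborel"
    using U AE_iff_null_sets[of ?U lborel] by simp
  then have "negligible ?U"
    by (simp add: negligible_iff_null_sets null_sets_completionI)
  then have "?U = {}"
    using open_not_negligible[OF U] by blast
  then have "v ` {1<..} \<subseteq> A"
    by auto
  moreover have "closure {1<..} = {1::real..}"
    by simp
  ultimately have "v ` {1..} \<subseteq> A"
    using image_closure_subset[of "{1<..}" v A] v A by simp
  then show ?thesis
    using r by auto
qed

text \<open>\<open>admissible\<close> provides a weak derivative of \<open>Q - Q_infty\<close>,
  whereas \<open>wderiv Q\<close> refers to \<open>Q\<close> itself. The continuous representative
  of \<open>Q\<close> has the same increments as its translate by \<open>- Q_infty\<close>, so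
  \<open>weak_derivative_dominated\<close> yields a weak derivative of it, which is also one of
  \<open>Q\<close>.\<close>

lemma admissible_wderiv:
  assumes Q: "Q \<in> admissible Q0"
  shows "Q \<in> borel_measurable (lebesgue_on {1<..})" "L2 (wderiv Q)" "weak_derivative Q (wderiv Q)"
proof -
  let ?u = "\<lambda>r. Q r - Q_infty"
  obtain v where v: "continuous_on {1..} v" "AE r in lebesgue_on {1<..}. v r = Q r"
    using Q by (auto simp: admissible_def trace_at_1_def)
  have vm: "v \<in> borel_measurable (lebesgue_on {1<..})"
    by (rule continuous_imp_measurable_on_sets_lebesgue[OF continuous_on_subset[OF v(1)]]) auto
  obtain w where w: "L2 w" "weak_derivative ?u w" and u: "?u \<in> borel_measurable (lebesgue_on {1<..})"
    using Q by (auto simp: admissible_def H1_def L2_def)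
  have "(\<lambda>r. ?u r + Q_infty) \<in> borel_measurable (lebesgue_on {1<..})"
    using u by (intro borel_measurable_add) auto
  then show Qm: "Q \<in> borel_measurable (lebesgue_on {1<..})"
    by simp
  have "\<exists>q. L2 q \<and> weak_derivative v q"
  proof (rule weak_derivative_dominated(1)[OF _ u _ w v(1)])
    show "continuous_on {1..} (\<lambda>r. v r - Q_infty)"
      by (intro continuous_intros v)
    show "AE r in lebesgue_on {1<..}. Q r - Q_infty = v r - Q_infty"
      using v(2) by eventually_elim simp
  qed simp
  then obtain q where "L2 q" "weak_derivative v q" by blast
  then have "\<exists>q. L2 q \<and> weak_derivative Q q"
    using weak_derivative_cong_AE[OF vm Qm v(2)] by blast
  then have "L2 (wderiv Q) \<and> weak_derivative Q (wderiv Q)"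
    unfolding wderiv_def by (rule someI_ex)
  then show "L2 (wderiv Q)" "weak_derivative Q (wderiv Q)"
    by auto
qed

text \<open>The set \<open>A\<close> serves both regimes: it is \<open>S0\<close> or the set of
  uniaxial tensors. As \<open>T\<close> fixes \<open>Q_infty\<close>, the Lipschitz bound also
  controls the distance to \<open>Q_infty\<close>, which keeps \<open>P\<close> in
  \<open>Q_infty + H1\<close>. \<open>F_zero\<close> coincides with \<open>F_infty\<close> on maps
  for which \<open>f_bulk\<close> vanishes almost everywhere.\<close>

lemma lipschitz_competitor:
  assumes A: "A \<subseteq> S0" "closed A" "Q_infty \<in> A" and T: "\<And>X. X \<in> A \<Longrightarrow> T X \<in> A" "T Q_infty = Q_infty"
    and lip: "\<And>X Y. X \<in> A \<Longrightarrow> Y \<in> A \<Longrightarrow> norm (T X - T Y) \<le> norm (X - Y)"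
    and g: "\<And>X. X \<in> A \<Longrightarrow> g_ext g0 (T X) \<le> g_ext g0 X"
    and Q: "Q \<in> admissible Q0" "AE r in lebesgue_on {1<..}. Q r \<in> A"
  shows "\<exists>P\<in>admissible (T Q0). (\<forall>r>1. P r \<in> A) \<and> F_zero g0 P \<le> F_zero g0 Q"
proof -
  note wQ = admissible_wderiv[OF Q(1)]
  obtain v where v: "continuous_on {1..} v" "AE r in lebesgue_on {1<..}. v r = Q r" "v 1 = Q0"
    using Q by (auto simp: admissible_def trace_at_1_def)
  have Qv: "AE r in lebesgue_on {1<..}. Q r = v r"
    using v(2) by eventually_elim simp
  have "AE r in lebesgue_on {1<..}. v r \<in> A"
    using v(2) Q(2) by eventually_elim simp
  then have vA: "v r \<in> A" if "1 \<le> r" for r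
    using continuous_AE_in_closed[OF v(1) A(2)] that by blast
  define P where "P r = T (v r)" for r
  have PA: "P r \<in> A" if "1 \<le> r" for r
    unfolding P_def using T(1) vA that by blast
  have "1-lipschitz_on A T"
    using lip by (auto simp: lipschitz_on_def dist_norm)
  then have "continuous_on {1..} (\<lambda>r. T (v r))"
    using vA by (intro continuous_on_compose2[OF lipschitz_on_continuous_on v(1)]) auto
  then have P: "continuous_on {1..} P"
    by (simp add: P_def[abs_def])
  have le: "norm (P t - P s) \<le> norm (v t - v s)" if "1 \<le> s" "s \<le> t" for s t
    unfolding P_def using that by (intro lip vA) auto
  have "\<exists>q. L2 q \<and> weak_derivative P q"
    by (rule weak_derivative_dominated(1)[OF v(1) wQ(1) Qv wQ(2,3) P le])
  then have "L2 (wderiv P) \<and> weak_derivative P (wderiv P)"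
    unfolding wderiv_def by (rule someI_ex)
  then have wle: "AE r in lebesgue_on {1<..}. norm (wderiv P r) \<le> norm (wderiv Q r)"
    by (intro weak_derivative_dominated(2)[OF v(1) wQ(1) Qv wQ(2,3) P le]) auto
  have P': "continuous_on {1..} (\<lambda>r. P r - Q_infty)"
    by (intro continuous_intros P)
  have "\<exists>q. L2 q \<and> weak_derivative (\<lambda>r. P r - Q_infty) q"
    by (rule weak_derivative_dominated(1)[OF v(1) wQ(1) Qv wQ(2,3) P']) (use le in simp)
  moreover have "L2 (\<lambda>r. P r - Q_infty)"
    unfolding L2_def
  proof
    show m: "(\<lambda>r. P r - Q_infty) \<in> borel_measurable (lebesgue_on {1<..})"
      by (rule continuous_imp_measurable_on_sets_lebesgue[OF continuous_on_subset[OF P']]) auto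
    have "integrable (lebesgue_on {1<..}) (\<lambda>r. norm (Q r - Q_infty) ^ 2)"
      using Q(1) by (auto simp: admissible_def H1_def L2_def)
    then show "integrable (lebesgue_on {1<..}) (\<lambda>r. norm (P r - Q_infty) ^ 2)"
    proof (rule Bochner_Integration.integrable_bound)
      show "(\<lambda>r. norm (P r - Q_infty) ^ 2) \<in> borel_measurable (lebesgue_on {1<..})"
        using m by measurable
      have "norm (P r - Q_infty) \<le> norm (v r - Q_infty)" if "1 \<le> r" for r
        using lip[OF vA[OF that] A(3)] by (simp add: P_def T(2))
      note le_v = this
      show "AE r in lebesgue_on {1<..}. norm (norm (P r - Q_infty) ^ 2) \<le> norm (norm (Q r - Q_infty) ^ 2)"
        using v(2) AE_space[of "lebesgue_on {1<..}"]
      proof eventually_elim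
        case (elim r)
        then show ?case
          using le_v[of r] by (auto intro!: power_mono)
      qed
    qed
  qed
  moreover have "trace_at_1 P (T Q0)"
    unfolding trace_at_1_def using P v(3) by (intro exI[of _ P]) (auto simp: P_def)
  ultimately have "P \<in> admissible (T Q0)"
    using PA A(1) by (auto simp: admissible_def H1_def)
  moreover have "F_zero g0 P \<le> F_zero g0 Q"
    unfolding F_zero_def
  proof (rule nn_integral_mono_AE)
    show "AE r in lebesgue_on {1<..}. ennreal (1 / 2 * norm (wderiv P r) ^ 2 + g_ext g0 (P r)) \<le>
        ennreal (1 / 2 * norm (wderiv Q r) ^ 2 + g_ext g0 (Q r))"
      using wle v(2) AE_space[of "lebesgue_on {1<..}"]
    proof eventually_elim
      case (elim r)
      then have "g_ext g0 (P r) \<le> g_ext g0 (Q r)"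
        using g[OF vA[of r]] by (auto simp: P_def)
      then show ?case
        using elim by (intro ennreal_leI add_mono mult_left_mono power_mono) auto
    qed
  qed
  ultimately show ?thesis
    using PA by (intro bexI[of _ P]) auto
qed

section \<open>Clamping the polar angle\<close>

text \<open>At \<open>X = 0\<close> division by 0 yields the angle \<open>pi / 2\<close>, which has
  no effect on \<open>polar_clamp\<close> because of the factor \<open>norm X\<close>.\<close>

definition polar_angle :: "'a::real_inner \<Rightarrow> 'a \<Rightarrow> real" where
  "polar_angle E X = arccos (E \<bullet> X / norm X)"

text \<open>Fold \<open>X\<close> around the axis \<open>E\<close> into the half-plane spanned by \<open>E\<close> and \<open>N\<close>, then cut its polar
  angle down to at most \<open>\<beta>\<close>.\<close>

definition polar_clamp :: "'a::real_inner \<Rightarrow> 'a \<Rightarrow> real \<Rightarrow> 'a \<Rightarrow> 'a" where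
  "polar_clamp E N \<beta> X = norm X *\<^sub>R
    (cos (min \<beta> (polar_angle E X)) *\<^sub>R E + sin (min \<beta> (polar_angle E X)) *\<^sub>R N)"

lemma polar_angle_arg_bounds:
  assumes "norm E = 1"
  shows "- 1 \<le> E \<bullet> X / norm X" "E \<bullet> X / norm X \<le> 1"
  using Cauchy_Schwarz_ineq2[of E X] assms by (cases "X = 0"; simp add: field_simps abs_le_iff)+

lemma polar_angle_bounds:
  assumes "norm E = 1"
  shows "0 \<le> polar_angle E X" "polar_angle E X \<le> pi"
  using polar_angle_arg_bounds[OF assms, of X] by (simp_all add: polar_angle_def arccos_lbound arccos_ubound)

lemma norm_times_cos_polar_angle:
  assumes "norm E = 1"
  shows "norm X * cos (polar_angle E X) = E \<bullet> X"
  using polar_angle_arg_bounds[OF assms, of X] by (simp add: polar_angle_def)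

lemma norm_minus_projection_squared:
  fixes E X :: "'a::real_inner"
  assumes "norm E = 1"
  shows "norm (X - (E \<bullet> X) *\<^sub>R E) ^ 2 = norm X ^ 2 - (E \<bullet> X) ^ 2"
proof -
  have "E \<bullet> E = 1" using assms by (simp add: norm_eq_1)
  then show ?thesis
    unfolding power2_norm_eq_inner
    by (simp add: inner_diff_left inner_diff_right inner_commute[of X E] power2_eq_square)
qed

text \<open>Split both vectors into components along \<open>E\<close> and orthogonal to it, governed
  by the cosine and the sine of the polar angle. Cauchy-Schwarz for the orthogonal components gives
  the bound; its right side is the inner product after folding into a half-plane.\<close>

lemma inner_le_cos_polar_angle_diff:
  assumes E: "norm E = 1"
  shows "X \<bullet> Y \<le> norm X * norm Y * cos (polar_angle E X - polar_angle E Y)"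
proof -
  let ?P = "\<lambda>X. X - (E \<bullet> X) *\<^sub>R E"
  have EE: "E \<bullet> E = 1" using E by (simp add: norm_eq_1)
  have perp: "norm (?P X) = norm X * sin (polar_angle E X)" for X
  proof (rule power2_eq_imp_eq)
    have "norm (?P X) ^ 2 = norm X ^ 2 - (E \<bullet> X) ^ 2"
      by (rule norm_minus_projection_squared[OF E])
    also have "\<dots> = (norm X * sin (polar_angle E X)) ^ 2"
      unfolding norm_times_cos_polar_angle[OF E, symmetric]
      by (simp add: power_mult_distrib sin_squared_eq algebra_simps)
    finally show "norm (?P X) ^ 2 = (norm X * sin (polar_angle E X)) ^ 2" .
    show "0 \<le> norm X * sin (polar_angle E X)"
      using polar_angle_bounds[OF E] by (intro mult_nonneg_nonneg sin_ge_zero) auto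
  qed simp
  have "X \<bullet> Y = (E \<bullet> X) * (E \<bullet> Y) + ?P X \<bullet> ?P Y"
    by (simp add: inner_diff_left inner_diff_right EE inner_commute)
  also have "\<dots> \<le> (E \<bullet> X) * (E \<bullet> Y) + norm (?P X) * norm (?P Y)"
    by (intro add_left_mono norm_cauchy_schwarz)
  also have "\<dots> = norm X * norm Y * cos (polar_angle E X - polar_angle E Y)"
    unfolding perp unfolding norm_times_cos_polar_angle[OF E, symmetric] by (simp add: cos_diff algebra_simps)
  finally show ?thesis .
qed

text \<open>Taking the minimum with \<beta> does not increase distances, and the cosine decreases on
  \<open>{0..pi}\<close>.\<close>

lemma cos_diff_le_cos_min_diff:
  assumes "0 \<le> a" "a \<le> pi" "0 \<le> b" "b \<le> pi" "0 \<le> \<beta>"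
  shows "cos (a - b) \<le> cos (min \<beta> a - min \<beta> b)"
proof -
  have "cos \<bar>a - b\<bar> \<le> cos \<bar>min \<beta> a - min \<beta> b\<bar>"
    using assms by (intro cos_monotone_0_pi_le) auto
  then show ?thesis by simp
qed

lemma inner_polar_clamp:
  assumes "norm E = 1" "norm N = 1" "E \<bullet> N = 0"
  shows "polar_clamp E N \<beta> X \<bullet> polar_clamp E N \<beta> Y =
    norm X * norm Y * cos (min \<beta> (polar_angle E X) - min \<beta> (polar_angle E Y))"
  using assms
  by (simp add: polar_clamp_def inner_add_left inner_add_right norm_eq_1 inner_commute[of N E] cos_diff algebra_simps)

lemma norm_polar_clamp:
  assumes "norm E = 1" "norm N = 1" "E \<bullet> N = 0"
  shows "norm (polar_clamp E N \<beta> X) = norm X"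
  unfolding norm_eq_sqrt_inner[of "polar_clamp E N \<beta> X"] inner_polar_clamp[OF assms] by simp

text \<open>Norms are preserved, so distances do not increase once inner products do not decrease.
  Folding and cutting the angle contribute one inequality each.\<close>

lemma polar_clamp_lipschitz:
  assumes E: "norm E = 1" "norm N = 1" "E \<bullet> N = 0" and \<beta>: "0 \<le> \<beta>"
  shows "norm (polar_clamp E N \<beta> X - polar_clamp E N \<beta> Y) \<le> norm (X - Y)"
proof (rule power2_le_imp_le)
  have "X \<bullet> Y \<le> norm X * norm Y * cos (polar_angle E X - polar_angle E Y)"
    by (rule inner_le_cos_polar_angle_diff[OF E(1)])
  also have "\<dots> \<le> polar_clamp E N \<beta> X \<bullet> polar_clamp E N \<beta> Y"
    unfolding inner_polar_clamp[OF E]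
    by (intro mult_left_mono cos_diff_le_cos_min_diff polar_angle_bounds[OF E(1)] \<beta>) auto
  finally show "norm (polar_clamp E N \<beta> X - polar_clamp E N \<beta> Y) ^ 2 \<le> norm (X - Y) ^ 2"
    using dot_norm_neg[of X Y] dot_norm_neg[of "polar_clamp E N \<beta> X" "polar_clamp E N \<beta> Y"]
    by (simp add: norm_polar_clamp[OF E])
qed simp

lemma inner_axis_polar_clamp:
  assumes "norm E = 1" "E \<bullet> N = 0"
  shows "E \<bullet> polar_clamp E N \<beta> X = norm X * cos (min \<beta> (polar_angle E X))"
  using assms by (simp add: polar_clamp_def inner_add_right norm_eq_1)

text \<open>Clamping only lowers the polar angle. This is the reason why \<open>g\<close> does not
  increase.\<close>

lemma inner_axis_le_polar_clamp:
  assumes "norm E = 1" "E \<bullet> N = 0" "0 \<le> \<beta>"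
  shows "E \<bullet> X \<le> E \<bullet> polar_clamp E N \<beta> X"
  unfolding inner_axis_polar_clamp[OF assms(1,2)] norm_times_cos_polar_angle[OF assms(1), of X, symmetric]
  using assms(3) polar_angle_bounds[OF assms(1), of X]
  by (intro mult_left_mono cos_monotone_0_pi_le) auto

lemma polar_clamp_axis:
  assumes "norm E = 1" "0 \<le> \<beta>" "0 \<le> c"
  shows "polar_clamp E N \<beta> (c *\<^sub>R E) = c *\<^sub>R E"
proof (cases "c = 0")
  case False
  then have "polar_angle E (c *\<^sub>R E) = 0"
    using assms(1,3) by (simp add: polar_angle_def dot_square_norm)
  then show ?thesis
    using assms by (simp add: polar_clamp_def)
qed (simp add: polar_clamp_def)

text \<open>The polar angle of \<open>X\<close> is at least \<beta> and is cut down to \<beta>. By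
  \<open>U\<close>, the point of the half-plane with that angle and the norm of \<open>X\<close> is
  \<open>U\<close>.\<close>

lemma polar_clamp_eq:
  assumes U: "U = norm U *\<^sub>R (cos \<beta> *\<^sub>R E + sin \<beta> *\<^sub>R N)" and E: "norm E = 1"
    and X: "norm X = norm U" "E \<bullet> X \<le> E \<bullet> U" and \<beta>: "\<beta> = polar_angle E U"
  shows "polar_clamp E N \<beta> X = U"
proof -
  have "\<beta> \<le> polar_angle E X"
    unfolding \<beta> polar_angle_def
    using X polar_angle_arg_bounds[OF E, of X] polar_angle_arg_bounds[OF E, of U]
    by (intro arccos_le_arccos) (auto intro: divide_right_mono)
  then show ?thesis
    using U by (simp add: polar_clamp_def X(1) min_absorb1)
qed

text \<open>\<open>N\<close> is the normalised component of \<open>U\<close> orthogonal to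
  \<open>E\<close>. If \<open>U\<close> lies on the axis, that component is 0 and \<open>N0\<close>
  takes its place. The subspace \<open>S\<close> keeps the half-plane inside \<open>S0\<close> in
  the application to tensors.\<close>

lemma polar_decomposition:
  fixes E U :: "'a::real_inner"
  assumes E: "norm E = 1" "E \<in> S" and N0: "norm N0 = 1" "E \<bullet> N0 = 0" "N0 \<in> S"
    and S: "subspace S" and U: "U \<in> S"
  shows "\<exists>N\<in>S. norm N = 1 \<and> E \<bullet> N = 0 \<and>
    U = norm U *\<^sub>R (cos (polar_angle E U) *\<^sub>R E + sin (polar_angle E U) *\<^sub>R N)"
proof -
  let ?P = "U - (E \<bullet> U) *\<^sub>R E"
  have EE: "E \<bullet> E = 1" using E by (simp add: norm_eq_1)
  have orth: "E \<bullet> ?P = 0"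
    by (simp add: inner_diff_right EE)
  have "norm (?P) ^ 2 = norm U ^ 2 - (E \<bullet> U) ^ 2"
    by (rule norm_minus_projection_squared[OF E(1)])
  also have "\<dots> = (norm U * sin (polar_angle E U)) ^ 2"
    unfolding norm_times_cos_polar_angle[OF E(1), symmetric]
    by (simp add: power_mult_distrib sin_squared_eq algebra_simps)
  finally have nP: "norm ?P = norm U * sin (polar_angle E U)"
    by (rule power2_eq_imp_eq)
       (use polar_angle_bounds[OF E(1), of U] in \<open>auto intro!: mult_nonneg_nonneg sin_ge_zero\<close>)
  have split: "U = norm U *\<^sub>R (cos (polar_angle E U) *\<^sub>R E + sin (polar_angle E U) *\<^sub>R N)"
    if "norm ?P *\<^sub>R N = ?P" for N
  proof -
    have "norm U *\<^sub>R (cos (polar_angle E U) *\<^sub>R E + sin (polar_angle E U) *\<^sub>R N) = (E \<bullet> U) *\<^sub>R E + norm ?P *\<^sub>R N"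
      unfolding nP by (simp add: scaleR_add_right norm_times_cos_polar_angle[OF E(1)])
    also have "\<dots> = U"
      unfolding that by simp
    finally show ?thesis ..
  qed
  show ?thesis
  proof (cases "?P = 0")
    case True
    then have "norm ?P *\<^sub>R N0 = ?P" by simp
    then show ?thesis
      using N0 by (intro bexI[of _ N0] conjI split)
  next
    case False
    then have "norm ?P *\<^sub>R ((1 / norm ?P) *\<^sub>R ?P) = ?P" "norm ((1 / norm ?P) *\<^sub>R ?P) = 1" by simp_all
    moreover have "E \<bullet> ((1 / norm ?P) *\<^sub>R ?P) = 0"
      using orth by simp
    moreover have "(1 / norm ?P) *\<^sub>R ?P \<in> S"
      using E U S by (intro subspace_scale subspace_diff)
    ultimately show ?thesis
      by (intro bexI[of _ "(1 / norm ?P) *\<^sub>R ?P"] conjI split)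
  qed
qed

section \<open>Uniaxial tensors\<close>

lemma inner_matrix_33: "X \<bullet> Y = (\<Sum>i\<in>UNIV. \<Sum>j\<in>UNIV. X $ i $ j * Y $ i $ j)" for X Y :: "real ^ 3 ^ 3"
  by (simp add: inner_vec_def)

lemma mem_S0_iff:
  "Q \<in> S0 \<longleftrightarrow> Q $ 2 $ 1 = Q $ 1 $ 2 \<and> Q $ 3 $ 1 = Q $ 1 $ 3 \<and> Q $ 3 $ 2 = Q $ 2 $ 3 \<and>
    Q $ 1 $ 1 + Q $ 2 $ 2 + Q $ 3 $ 3 = 0"
  by (auto simp: S0_def transpose_def trace_def vec_eq_iff forall_3 sum_3)

lemma subspace_S0: "subspace S0"
  unfolding subspace_def mem_S0_iff
proof (intro conjI ballI allI impI)
  fix Q :: "real ^ 3 ^ 3" and c :: real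
  assume "Q \<in> S0"
  then have "c * (Q $ 1 $ 1 + Q $ 2 $ 2 + Q $ 3 $ 3) = 0"
    by (simp add: mem_S0_iff)
  then show "(c *\<^sub>R Q) $ 1 $ 1 + (c *\<^sub>R Q) $ 2 $ 2 + (c *\<^sub>R Q) $ 3 $ 3 = 0"
    by (simp add: distrib_left)
qed (auto simp: mem_S0_iff)

lemma closed_S0: "closed S0"
  by (rule closed_subspace[OF subspace_S0])

lemma uniax_nth: "uniax n $ i $ j = n $ i * n $ j - (if i = j then 1 / 3 else 0)"
  by (simp add: uniax_def mat_def)

lemma norm_vec_3: "norm n = 1 \<longleftrightarrow> n $ 1 ^ 2 + n $ 2 ^ 2 + n $ 3 ^ 2 = 1" for n :: "real ^ 3"
  by (simp add: norm_eq_1 inner_vec_def sum_3 power2_eq_square)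

lemma uniax_mem_S0: "norm n = 1 \<Longrightarrow> uniax n \<in> S0"
  by (simp add: mem_S0_iff uniax_nth norm_vec_3 power2_eq_square)

lemma inner_uniax: "norm n = 1 \<Longrightarrow> norm m = 1 \<Longrightarrow> uniax n \<bullet> uniax m = (n \<bullet> m) ^ 2 - 1 / 3"
proof -
  assume nm: "norm n = 1" "norm m = 1"
  have "uniax n \<bullet> uniax m = (n \<bullet> m) ^ 2 -
      (n $ 1 ^ 2 + n $ 2 ^ 2 + n $ 3 ^ 2 + (m $ 1 ^ 2 + m $ 2 ^ 2 + m $ 3 ^ 2)) / 3 + 1 / 3"
    unfolding inner_matrix_33 by (simp add: uniax_nth sum_3 inner_vec_def power2_eq_square field_simps)
  then show ?thesis
    using nm by (simp add: norm_vec_3)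
qed

lemma uniax_minus: "uniax (- n) = uniax n"
  by (simp add: vec_eq_iff uniax_nth)

lemma norm_axis_3: "norm (axis 3 1 :: real ^ 3) = 1"
  by (simp add: norm_axis_1)

lemma inner_Q_infty: "Q \<in> S0 \<Longrightarrow> Q_infty \<bullet> Q = Q $ 3 $ 3"
  by (simp add: mem_S0_iff inner_matrix_33 Q_infty_def uniax_nth sum_3 axis_def)

lemma norm_uniax: "norm n = 1 \<Longrightarrow> norm (uniax n) = sqrt (2 / 3)"
  using inner_uniax[of n n] by (simp add: norm_eq_sqrt_inner)

lemma norm_uniax_diff_squared:
  assumes "norm n = 1" "norm m = 1"
  shows "norm (uniax n - uniax m) ^ 2 = 2 - 2 * (n \<bullet> m) ^ 2"
  using assms inner_uniax[OF assms] dot_norm_neg[of "uniax n" "uniax m"] by (simp add: norm_uniax)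

section \<open>The zero set of the bulk potential\<close>

text \<open>Expanding the square leaves the trace of the fourth power of \<open>Q\<close>, which is
  half of \<open>norm Q ^ 4\<close> for symmetric traceless matrices. The proof verifies the
  polynomial identity in the five independent entries.\<close>

lemma f_bulk_eq:
  assumes "Q \<in> S0"
  shows "f_bulk Q = 3 / 2 * norm (Q ** Q - (1 / 3) *\<^sub>R Q - (2 / 9) *\<^sub>R mat 1) ^ 2"
proof -
  have n2: "norm X ^ 2 = (\<Sum>i\<in>UNIV. \<Sum>j\<in>UNIV. X $ i $ j * X $ i $ j)" for X :: "real ^ 3 ^ 3"
    unfolding power2_norm_eq_inner inner_matrix_33 ..
  have n4: "norm Q ^ 4 = (norm Q ^ 2) ^ 2"
    by simp
  have s: "Q $ 2 $ 1 = Q $ 1 $ 2" "Q $ 3 $ 1 = Q $ 1 $ 3" "Q $ 3 $ 2 = Q $ 2 $ 3"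
    "Q $ 3 $ 3 = - (Q $ 1 $ 1 + Q $ 2 $ 2)"
    using assms by (auto simp: mem_S0_iff)
  show ?thesis
    unfolding f_bulk_def n4 n2
    by (simp add: matrix_matrix_mult_def trace_def sum_3 mat_def s power2_eq_square algebra_simps
        add_divide_distrib diff_divide_distrib)
qed

text \<open>The symmetric matrix \<open>M\<close> with rows \<open>a b c\<close>,
  \<open>b d e\<close>, \<open>c e f\<close> is idempotent with trace 1. Its second invariant is
  therefore 0, and by Cayley-Hamilton its adjugate, whose entries are the 2x2 minors up to sign,
  equals \<open>M^2 - M = 0\<close>.\<close>

lemma rank_one_minors:
  fixes a b c d e f :: real
  assumes "a * a + b * b + c * c = a" "a * b + b * d + c * e = b" "a * c + b * e + c * f = c"
    "b * b + d * d + e * e = d" "b * c + d * e + e * f = e" "c * c + e * e + f * f = f" "a + d + f = 1"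
  shows "a * d = b * b" "a * f = c * c" "d * f = e * e" "a * e = b * c" "d * c = b * e" "f * b = c * e"
proof -
  have e2: "a * d + a * f + d * f - b * b - c * c - e * e = 0"
  proof -
    have "2 * (a * d + a * f + d * f - b * b - c * c - e * e) = (a + d + f) * (a + d + f) -
        ((a * a + b * b + c * c) + (b * b + d * d + e * e) + (c * c + e * e + f * f))"
      by (simp add: algebra_simps)
    then show ?thesis
      using assms by simp
  qed
  have "a * d - b * b = (c * c + e * e + f * f) - f * (a + d + f) + (a * d + a * f + d * f - b * b - c * c - e * e)"
    by (simp add: algebra_simps)
  then show "a * d = b * b" using assms e2 by simp
  have "a * f - c * c = (b * b + d * d + e * e) - d * (a + d + f) + (a * d + a * f + d * f - b * b - c * c - e * e)"
    by (simp add: algebra_simps)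
  then show "a * f = c * c" using assms e2 by simp
  have "d * f - e * e = (a * a + b * b + c * c) - a * (a + d + f) + (a * d + a * f + d * f - b * b - c * c - e * e)"
    by (simp add: algebra_simps)
  then show "d * f = e * e" using assms e2 by simp
  have "b * c - a * e = (b * c + d * e + e * f) - e * (a + d + f)"
    by (simp add: algebra_simps)
  then show "a * e = b * c" using assms by simp
  have "b * e - d * c = (a * c + b * e + c * f) - c * (a + d + f)"
    by (simp add: algebra_simps)
  then show "d * c = b * e" using assms by simp
  have "c * e - f * b = (a * b + b * d + c * e) - b * (a + d + f)"
    by (simp add: algebra_simps)
  then show "f * b = c * e" using assms by simp
qed

text \<open>By \<open>f_bulk_eq\<close>, \<open>Q + I/3\<close> is idempotent with trace 1, hence
  the projection onto a line. Passing from \<open>n\<close> to \<open>- n\<close> arranges the sign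
  of the third component.\<close>

lemma f_bulk_zero_imp_uniax:
  assumes Q: "Q \<in> S0" "f_bulk Q = 0"
  shows "\<exists>n. norm n = 1 \<and> 0 \<le> n $ 3 \<and> Q = uniax n"
proof -
  have s: "Q $ 2 $ 1 = Q $ 1 $ 2" "Q $ 3 $ 1 = Q $ 1 $ 3" "Q $ 3 $ 2 = Q $ 2 $ 3"
    "Q $ 3 $ 3 = - (Q $ 1 $ 1 + Q $ 2 $ 2)"
    using Q(1) by (auto simp: mem_S0_iff)
  define a where "a = Q $ 1 $ 1 + 1 / 3"
  define b where "b = Q $ 1 $ 2"
  define c where "c = Q $ 1 $ 3"
  define d where "d = Q $ 2 $ 2 + 1 / 3"
  define e where "e = Q $ 2 $ 3"
  define f where "f = Q $ 3 $ 3 + 1 / 3"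
  note defs = a_def b_def c_def d_def e_def f_def
  have M: "Q ** Q - (1 / 3) *\<^sub>R Q - (2 / 9) *\<^sub>R mat 1 = 0"
    using Q f_bulk_eq[OF Q(1)] by simp
  have entry: "(\<Sum>k\<in>UNIV. Q $ i $ k * Q $ k $ j) = Q $ i $ j / 3 + (if i = j then 2 / 9 else 0)" for i j
    using arg_cong[OF M, of "\<lambda>X. X $ i $ j"] by (simp add: matrix_matrix_mult_def mat_def split: if_splits)
  have tr: "a + d + f = 1"
    by (simp add: defs s)
  have "a * a + b * b + c * c = a" "a * b + b * d + c * e = b" "a * c + b * e + c * f = c"
    "b * b + d * d + e * e = d" "b * c + d * e + e * f = e" "c * c + e * e + f * f = f"
    using entry[of 1 1] entry[of 1 2] entry[of 1 3] entry[of 2 2] entry[of 2 3] entry[of 3 3]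
    unfolding defs sum_3 s(1-3) by (simp_all add: algebra_simps)
  note sq = this tr
  note minors = rank_one_minors[OF sq]
  have Qeq: "Q = uniax n" if "n $ 1 * n $ 1 = a" "n $ 1 * n $ 2 = b" "n $ 1 * n $ 3 = c"
    "n $ 2 * n $ 2 = d" "n $ 2 * n $ 3 = e" "n $ 3 * n $ 3 = f" for n
    using that s by (auto simp: vec_eq_iff forall_3 uniax_nth defs mult.commute)
  have "0 \<le> a" "0 \<le> d" "0 \<le> f"
    using sq(1,4,6) zero_le_square[of a] zero_le_square[of b] zero_le_square[of c] zero_le_square[of d]
      zero_le_square[of e] zero_le_square[of f] by linarith+
  \<comment> \<open>The diagonal entries are nonnegative with sum 1. The column through a positive
    one, divided by the root of that entry, is the vector \<open>n\<close>.\<close>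
  then consider "0 < a" | "0 < d" | "0 < f"
    using tr by linarith
  then have "\<exists>n. Q = uniax n"
  proof cases
    case 1
    then have "sqrt a * sqrt a = a" "sqrt a > 0" by simp_all
    then show ?thesis
      using minors 1 by (intro exI[of _ "vector [sqrt a, b / sqrt a, c / sqrt a]"] Qeq)
        (simp_all add: field_simps)
  next
    case 2
    then have "sqrt d * sqrt d = d" "sqrt d > 0" by simp_all
    then show ?thesis
      using minors 2 by (intro exI[of _ "vector [b / sqrt d, sqrt d, e / sqrt d]"] Qeq)
        (simp_all add: field_simps)
  next
    case 3
    then have "sqrt f * sqrt f = f" "sqrt f > 0" by simp_all
    then show ?thesis
      using minors 3 by (intro exI[of _ "vector [c / sqrt f, e / sqrt f, sqrt f]"] Qeq)
        (simp_all add: field_simps)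
  qed
  then obtain n where n: "Q = uniax n" by blast
  have "norm n = 1"
    using Q(1) unfolding n norm_vec_3 by (simp add: mem_S0_iff uniax_nth power2_eq_square)
  then show ?thesis
    using n uniax_minus[of n] by (cases "0 \<le> n $ 3") (force intro: exI[of _ n] exI[of _ "- n"])+
qed

lemma f_bulk_uniax:
  assumes "norm n = 1"
  shows "f_bulk (uniax n) = 0"
proof -
  have n: "n $ 1 ^ 2 + n $ 2 ^ 2 + n $ 3 ^ 2 = 1"
    using assms by (simp add: norm_vec_3)
  have "(\<Sum>k\<in>UNIV. uniax n $ i $ k * uniax n $ k $ j) =
      (n $ i * n $ j) * (n $ 1 ^ 2 + n $ 2 ^ 2 + n $ 3 ^ 2) - 2 / 3 * (n $ i * n $ j) + (if i = j then 1 / 9 else 0)" for i j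
    using exhaust_3[of i] exhaust_3[of j]
    by (auto simp: sum_3 uniax_nth power2_eq_square algebra_simps)
  then have "uniax n ** uniax n - (1 / 3) *\<^sub>R uniax n - (2 / 9) *\<^sub>R mat 1 = 0"
    unfolding n by (simp add: vec_eq_iff matrix_matrix_mult_def mat_def uniax_nth diff_divide_distrib)
  then show ?thesis
    using f_bulk_eq[OF uniax_mem_S0[OF assms]] by simp
qed

section \<open>Comparison of boundary values\<close>

text \<open>Only the projection of \<open>axis 3 1\<close> orthogonal to \<omega> contributes to
  \<open>v $ 3\<close>, so Cauchy-Schwarz bounds it by the length \<open>sin \<phi>\<close> of that
  projection, which \<open>e\<close> attains up to sign. At the poles \<open>v $ 3\<close> is
  0.\<close>

lemma e_phi_maximizes_third_component:
  assumes e: "e \<in> e_phi \<omega>" and \<omega>: "norm \<omega> = 1" and v: "norm v = 1" "v \<bullet> \<omega> = 0"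
  shows "norm e = 1" "(v $ 3) ^ 2 \<le> (e $ 3) ^ 2"
proof -
  have "norm e = 1 \<and> (v $ 3) ^ 2 \<le> (e $ 3) ^ 2"
  proof (cases "\<omega> = axis 3 1 \<or> \<omega> = - axis 3 1")
    case True
    then have "norm e = 1" "v $ 3 = 0"
      using e v(2) by (auto simp: e_phi_def inner_axis)
    then show ?thesis by simp
  next
    case False
    then obtain \<theta> \<phi> where e_eq: "e = vector [cos \<phi> * cos \<theta>, cos \<phi> * sin \<theta>, - sin \<phi>]"
      and \<omega>_eq: "\<omega> = vector [sin \<phi> * cos \<theta>, sin \<phi> * sin \<theta>, cos \<phi>]"
      using e unfolding e_phi_def if_not_P[OF False] by blast
    have "(cos \<phi> * cos \<theta>) ^ 2 + (cos \<phi> * sin \<theta>) ^ 2 = (cos \<phi>) ^ 2 * ((cos \<theta>) ^ 2 + (sin \<theta>) ^ 2)"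
      by (simp only: power_mult_distrib distrib_left)
    then have "norm e = 1"
      unfolding norm_vec_3 by (simp add: e_eq)
    moreover have "(v $ 3) ^ 2 \<le> (e $ 3) ^ 2"
    proof -
      have "v $ 3 = (axis 3 1 - (\<omega> \<bullet> axis 3 1) *\<^sub>R \<omega>) \<bullet> v"
        using v(2) by (simp add: inner_diff_left inner_axis' inner_commute[of \<omega> v])
      then have "(v $ 3) ^ 2 \<le> norm (axis 3 1 - (\<omega> \<bullet> axis 3 1) *\<^sub>R \<omega>) ^ 2"
        using Cauchy_Schwarz_ineq[of "axis 3 1 - (\<omega> \<bullet> axis 3 1) *\<^sub>R \<omega>" v] v(1)
        by (simp add: dot_square_norm)
      also have "\<dots> = 1 - (cos \<phi>) ^ 2"
        using norm_minus_projection_squared[OF \<omega>, of "axis 3 1"]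
        by (simp add: norm_axis_3 inner_axis \<omega>_eq)
      also have "\<dots> = (e $ 3) ^ 2"
        by (simp add: e_eq sin_squared_eq)
      finally show ?thesis .
    qed
    ultimately show ?thesis ..
  qed
  then show "norm e = 1" "(v $ 3) ^ 2 \<le> (e $ 3) ^ 2" by auto
qed

section \<open>The competitors in the two regimes\<close>

text \<open>On \<open>S0\<close> the inner product with \<open>Q_infty\<close> is the entry
  \<open>Q $ 3 $ 3\<close>, so by the comparison of third components the polar angle of
  \<open>uniax v\<close> is at least that of \<open>uniax e\<close>. Clamping at the latter angle
  maps \<open>uniax v\<close> to \<open>uniax e\<close>.\<close>

lemma competitor_zero:
  assumes e: "norm e = 1" and v: "norm v = 1" "(v $ 3) ^ 2 \<le> (e $ 3) ^ 2"
    and Q: "Q \<in> admissible (uniax v)"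
  shows "\<exists>P\<in>admissible (uniax e). F_zero g0 P \<le> F_zero g0 Q"
proof -
  define c :: real where "c = sqrt (2 / 3)"
  have c: "0 < c" by (simp add: c_def)
  have QS: "Q_infty \<in> S0" and Qn: "norm Q_infty = c"
    unfolding Q_infty_def c_def by (auto intro: uniax_mem_S0 norm_uniax norm_axis_3)
  define E where "E = (1 / c) *\<^sub>R Q_infty"
  have E: "norm E = 1" "E \<in> S0" and QE: "Q_infty = c *\<^sub>R E"
    using c QS Qn subspace_S0 by (auto simp: E_def subspace_scale)
  have EX: "E \<bullet> X = X $ 3 $ 3 / c" if "X \<in> S0" for X
    using inner_Q_infty[OF that] by (simp add: E_def)
  \<comment> \<open>A unit tensor in \<open>S0\<close> orthogonal to \<open>E\<close>, for the case
    that \<open>uniax e\<close> lies on the axis.\<close>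
  define N0 where "N0 = (1 / sqrt 2) *\<^sub>R (uniax (axis 1 1) - uniax (axis 2 1))"
  have a: "norm (axis 1 1 :: real ^ 3) = 1" "norm (axis 2 1 :: real ^ 3) = 1"
    by (simp_all add: norm_axis_1)
  have N0S: "N0 \<in> S0"
    unfolding N0_def by (intro subspace_scale subspace_diff subspace_S0 uniax_mem_S0 a)
  have "norm (uniax (axis 1 1) - uniax (axis 2 1)) = sqrt 2"
    by (rule power2_eq_imp_eq) (simp_all add: norm_uniax_diff_squared[OF a] inner_axis_axis)
  then have N0: "norm N0 = 1"
    by (simp add: N0_def)
  have "E \<bullet> N0 = 0"
    unfolding EX[OF N0S] by (simp add: N0_def uniax_nth axis_def)
  note N0 = N0 this N0S
  let ?\<beta> = "polar_angle E (uniax e)"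
  obtain N where N: "N \<in> S0" "norm N = 1" "E \<bullet> N = 0"
    and Ue: "uniax e = norm (uniax e) *\<^sub>R (cos ?\<beta> *\<^sub>R E + sin ?\<beta> *\<^sub>R N)"
    using polar_decomposition[OF E N0 subspace_S0 uniax_mem_S0[OF e]] by blast
  let ?T = "polar_clamp E N ?\<beta>"
  have \<beta>: "0 \<le> ?\<beta>" by (rule polar_angle_bounds[OF E(1)])
  have TS: "?T X \<in> S0" for X
    unfolding polar_clamp_def by (intro subspace_scale subspace_add subspace_S0 E N)
  have "?T (uniax v) = uniax e"
  proof (rule polar_clamp_eq[OF Ue E(1)])
    show "norm (uniax v) = norm (uniax e)"
      using e v(1) by (simp add: norm_uniax)
    show "E \<bullet> uniax v \<le> E \<bullet> uniax e"
      using c v(2) by (simp add: EX uniax_mem_S0 e v(1) uniax_nth divide_right_mono power2_eq_square)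
  qed simp
  moreover have "\<exists>P\<in>admissible (?T (uniax v)). (\<forall>r>1. P r \<in> S0) \<and> F_zero g0 P \<le> F_zero g0 Q"
  proof (rule lipschitz_competitor[OF subset_refl closed_S0 QS TS])
    show "?T Q_infty = Q_infty"
      unfolding QE using c by (intro polar_clamp_axis E \<beta>) auto
    show "g_ext g0 (?T X) \<le> g_ext g0 X" if X: "X \<in> S0" for X
    proof -
      \<comment> \<open>Since norms are preserved, only 0 is mapped to 0: there \<open>g0\<close> is
        compared with itself, and elsewhere the denominators in \<open>g\<close> agree.\<close>
      have n: "norm (?T X) = norm X"
        by (rule norm_polar_clamp[OF E(1) N(2,3)])
      then have z: "?T X = 0 \<longleftrightarrow> X = 0"
        by (metis norm_eq_zero)
      have "X $ 3 $ 3 \<le> ?T X $ 3 $ 3"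
        using inner_axis_le_polar_clamp[OF E(1) N(3) \<beta>, of X] c by (simp add: EX X TS divide_le_cancel)
      then show ?thesis
        by (auto simp: g_ext_def z n divide_right_mono)
    qed
    show "AE r in lebesgue_on {1<..}. Q r \<in> S0"
      using Q AE_space[of "lebesgue_on {1<..}"] by (auto simp: admissible_def)
  qed (use TS Q polar_clamp_lipschitz[OF E(1) N(2,3) \<beta>] in auto)
  ultimately show ?thesis
    by auto
qed

text \<open>Distances between uniaxial tensors depend on the directors through
  \<open>(n \<bullet> m) ^ 2\<close> only, so it is enough that clamping directors does not decrease
  these squares. The directors are taken in the closed upper hemisphere for this purpose; the
  estimate holds for either choice of sign on the equator.\<close>

lemma competitor_infty:
  assumes e: "norm e = 1" and v: "norm v = 1" "(v $ 3) ^ 2 \<le> (e $ 3) ^ 2"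
    and Q: "Q \<in> admissible (uniax v)" and f: "AE r in lebesgue_on {1<..}. f_bulk (Q r) = 0"
  shows "\<exists>P\<in>admissible (uniax e). (\<forall>r>1. f_bulk (P r) = 0) \<and> F_zero g0 P \<le> F_zero g0 Q"
proof -
  let ?A = "uniax ` sphere 0 1"
  let ?E = "axis 3 1 :: real ^ 3"
  have A_S0: "?A \<subseteq> S0"
    using uniax_mem_S0 by auto
  have "continuous_on (sphere 0 1) uniax"
    unfolding uniax_def[abs_def] by (intro continuous_intros)
  then have A_closed: "closed ?A"
    by (intro compact_imp_closed compact_continuous_image) auto
  have QA: "Q_infty \<in> ?A"
    unfolding Q_infty_def by (rule imageI) (simp add: norm_axis_3)
  define rep where "rep X = (SOME n. norm n = 1 \<and> 0 \<le> n $ 3 \<and> X = uniax n)" for X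
  have rep: "norm (rep X) = 1 \<and> 0 \<le> rep X $ 3 \<and> X = uniax (rep X)" if "X \<in> ?A" for X
  proof -
    have "\<exists>n. norm n = 1 \<and> 0 \<le> n $ 3 \<and> X = uniax n"
      using that f_bulk_zero_imp_uniax[of X] f_bulk_uniax uniax_mem_S0 by auto
    then show ?thesis
      unfolding rep_def by (rule someI_ex)
  qed
  \<comment> \<open>\<open>rep\<close> takes values in the upper hemisphere, so the target of the
    clamp is whichever of \<open>e\<close> and \<open>- e\<close> lies there.\<close>
  define u where "u = (if 0 \<le> e $ 3 then e else - e)"
  have u: "norm u = 1" "0 \<le> u $ 3" "uniax u = uniax e" "(u $ 3) ^ 2 = (e $ 3) ^ 2"
    using e by (auto simp: u_def uniax_minus)
  let ?\<beta> = "polar_angle ?E u"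
  obtain N where N: "norm N = 1" "?E \<bullet> N = 0"
    and U: "u = norm u *\<^sub>R (cos ?\<beta> *\<^sub>R ?E + sin ?\<beta> *\<^sub>R N)"
    using polar_decomposition[OF norm_axis_3 UNIV_I _ _ UNIV_I subspace_UNIV UNIV_I, of "axis 1 1" u]
    by (simp add: norm_axis_1 inner_axis_axis) blast
  have \<beta>: "0 \<le> ?\<beta>" by (rule polar_angle_bounds[OF norm_axis_3])
  let ?C = "polar_clamp ?E N ?\<beta>"
  let ?T = "\<lambda>X. uniax (?C (rep X))"
  note nC = norm_polar_clamp[OF norm_axis_3 N]
  have TA: "?T X \<in> ?A" if "X \<in> ?A" for X
    using rep[OF that] by (intro imageI) (simp add: nC)
  have C3: "n $ 3 \<le> ?C n $ 3" for n
    using inner_axis_le_polar_clamp[OF norm_axis_3 N(2) \<beta>, of n] by (simp add: inner_axis')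
  have C_inner: "(n \<bullet> m) ^ 2 \<le> (?C n \<bullet> ?C m) ^ 2"
    if n: "norm n = 1" "0 \<le> n $ 3" and m: "norm m = 1" "0 \<le> m $ 3" for n m
  proof -
    let ?a = "polar_angle ?E"
    have bd: "0 \<le> ?a x" "?a x \<le> pi" for x
      by (rule polar_angle_bounds[OF norm_axis_3])+
    have "n \<bullet> m \<le> cos (?a n - ?a m)"
      using inner_le_cos_polar_angle_diff[OF norm_axis_3, of n m] n m by simp
    \<comment> \<open>The square also requires a bound for the opposite sign. Passing to
      \<open>- n\<close> replaces its angle by the supplement, and the resulting
      \<open>- cos (a + b)\<close> is at most \<open>cos (a - b)\<close> because both cosines are
      nonnegative on the upper hemisphere.\<close>
    moreover have "- (n \<bullet> m) \<le> cos (?a n - ?a m)"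
    proof -
      have "?a (- n) = pi - ?a n"
        using polar_angle_arg_bounds[OF norm_axis_3, of n] by (simp add: polar_angle_def arccos_minus)
      then have "- (n \<bullet> m) \<le> cos (pi - ?a n - ?a m)"
        using inner_le_cos_polar_angle_diff[OF norm_axis_3, of "- n" m] n m by simp
      also have "\<dots> = sin (?a n) * sin (?a m) - cos (?a n) * cos (?a m)"
        by (simp add: cos_diff sin_diff)
      also have "\<dots> \<le> cos (?a n - ?a m)"
      proof -
        have "cos (?a x) = x $ 3" if "norm x = 1" for x
          using norm_times_cos_polar_angle[OF norm_axis_3, of x] that by (simp add: inner_axis')
        then have "0 \<le> cos (?a n) * cos (?a m)"
          using n m by simp
        then show ?thesis
          unfolding cos_diff by linarith
      qed
      finally show ?thesis .
    qed
    moreover have "cos (?a n - ?a m) \<le> ?C n \<bullet> ?C m"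
      using cos_diff_le_cos_min_diff[OF bd bd \<beta>, of n m] n m
      by (simp add: inner_polar_clamp[OF norm_axis_3 N])
    ultimately have "\<bar>n \<bullet> m\<bar> \<le> ?C n \<bullet> ?C m"
      by linarith
    then show ?thesis
      by (metis abs_ge_zero power2_abs power_mono)
  qed
  have v3: "uniax v $ 3 $ 3 = v $ 3 ^ 2 - 1 / 3" for v
    by (simp add: uniax_nth power2_eq_square)
  have vA: "uniax v \<in> ?A"
    using v(1) by auto
  have "?C (rep (uniax v)) = u"
  proof (rule polar_clamp_eq[OF U norm_axis_3])
    show "norm (rep (uniax v)) = norm u"
      using rep[OF vA] u by simp
    have "rep (uniax v) $ 3 ^ 2 = v $ 3 ^ 2"
      using rep[OF vA] v3[of v] v3[of "rep (uniax v)"] by simp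
    then have "rep (uniax v) $ 3 ^ 2 \<le> u $ 3 ^ 2"
      using v(2) u(4) by simp
    then show "?E \<bullet> rep (uniax v) \<le> ?E \<bullet> u"
      using u(2) by (auto simp: inner_axis' intro: power2_le_imp_le)
  qed simp
  then have Tv: "?T (uniax v) = uniax e"
    using u by simp
  have "\<exists>P\<in>admissible (?T (uniax v)). (\<forall>r>1. P r \<in> ?A) \<and> F_zero g0 P \<le> F_zero g0 Q"
  proof (rule lipschitz_competitor[OF A_S0 A_closed QA TA])
    have r: "norm (rep Q_infty) = 1" "0 \<le> rep Q_infty $ 3" "Q_infty = uniax (rep Q_infty)"
      using rep[OF QA] by auto
    \<comment> \<open>This entry leaves only the directors \<open>axis 3 1\<close> and
      \<open>- axis 3 1\<close>, and the hemisphere selects the former.\<close>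
    have "Q_infty $ 3 $ 3 = 2 / 3"
      by (simp add: Q_infty_def uniax_nth axis_def)
    then have "rep Q_infty $ 3 ^ 2 = 1"
      using v3[of "rep Q_infty"] r by simp
    then have "rep Q_infty = ?E"
      using r(1,2) unfolding norm_vec_3
      by (auto simp: vec_eq_iff forall_3 axis_def power2_eq_1_iff add_nonneg_eq_0_iff)
    moreover have "?C ?E = ?E"
      using polar_clamp_axis[OF norm_axis_3 \<beta>, of 1] by simp
    ultimately show "?T Q_infty = Q_infty"
      by (simp add: Q_infty_def)
    show "norm (?T X - ?T Y) \<le> norm (X - Y)" if "X \<in> ?A" "Y \<in> ?A" for X Y
    proof (rule power2_le_imp_le)
      note rX = rep[OF that(1)] and rY = rep[OF that(2)]
      have "norm (?T X - ?T Y) ^ 2 = 2 - 2 * (?C (rep X) \<bullet> ?C (rep Y)) ^ 2"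
        using rX rY by (intro norm_uniax_diff_squared) (auto simp: nC)
      also have "\<dots> \<le> 2 - 2 * (rep X \<bullet> rep Y) ^ 2"
        using C_inner[of "rep X" "rep Y"] rX rY by simp
      also have "\<dots> = norm (X - Y) ^ 2"
        using norm_uniax_diff_squared[of "rep X" "rep Y"] rX rY by metis
      finally show "norm (?T X - ?T Y) ^ 2 \<le> norm (X - Y) ^ 2" .
    qed simp
    show "g_ext g0 (?T X) \<le> g_ext g0 X" if X: "X \<in> ?A" for X
    proof -
      note rX = rep[OF X]
      have n: "norm (?T X) = sqrt (2 / 3)" "norm X = sqrt (2 / 3)"
        using rX norm_uniax[of "rep X"] by (simp_all add: norm_uniax nC)
      then have nz: "?T X \<noteq> 0" "X \<noteq> 0"
        by auto
      have "X $ 3 $ 3 = rep X $ 3 ^ 2 - 1 / 3"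
        using rX v3[of "rep X"] by simp
      moreover have "rep X $ 3 ^ 2 \<le> ?C (rep X) $ 3 ^ 2"
        using rX C3 by (intro power_mono) auto
      ultimately have "X $ 3 $ 3 \<le> ?T X $ 3 $ 3"
        by (simp add: v3)
      then show ?thesis
        unfolding g_ext_def using nz n by (simp add: divide_right_mono)
    qed
    show "AE r in lebesgue_on {1<..}. Q r \<in> ?A"
      using f AE_space[of "lebesgue_on {1<..}"]
    proof eventually_elim
      case (elim r)
      then show ?case
        using f_bulk_zero_imp_uniax[of "Q r"] Q by (auto simp: admissible_def)
    qed
  qed (use Q in auto)
  then obtain P where P: "P \<in> admissible (uniax e)" "\<And>r. r > 1 \<Longrightarrow> P r \<in> ?A" "F_zero g0 P \<le> F_zero g0 Q"
    unfolding Tv by blast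
  have "f_bulk (P r) = 0" if "r > 1" for r
    using P(2)[OF that] f_bulk_uniax by auto
  then show ?thesis
    using P(1,3) by blast
qed

theorem theorem1p2:
  fixes g0 :: real and lam :: regime and \<omega> v e :: "real ^ 3"
  assumes "0 \<le> g0"
    and "norm \<omega> = 1"
    and "norm v = 1" and "v \<bullet> \<omega> = 0"
    and "e \<in> e_phi \<omega>"
  shows "D g0 lam (uniax v) \<ge> D g0 lam (uniax e)"
proof -
  note e = e_phi_maximizes_third_component[OF assms(5,2-4)]
  have "\<exists>P\<in>admissible (uniax e). F g0 lam P \<le> F g0 lam Q" if Q: "Q \<in> admissible (uniax v)" for Q
  proof (cases lam)
    case Lambda_zero
    then show ?thesis
      using competitor_zero[OF e(1) assms(3) e(2) Q] by simp
  next
    case Lambda_infty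
    show ?thesis
    proof (cases "AE r in lebesgue_on {1<..}. f_bulk (Q r) = 0")
      case True
      then obtain P where P: "P \<in> admissible (uniax e)" "\<And>r. r > 1 \<Longrightarrow> f_bulk (P r) = 0" "F_zero g0 P \<le> F_zero g0 Q"
        using competitor_infty[OF e(1) assms(3) e(2) Q] by blast
      then have "AE r in lebesgue_on {1<..}. f_bulk (P r) = 0"
        using AE_space[of "lebesgue_on {1<..}"] by auto
      then show ?thesis
        using True P Lambda_infty by (intro bexI[of _ P]) (auto simp: F_infty_def F_zero_def)
    next
      case False
      then have top: "F g0 lam Q = \<infinity>"
        unfolding Lambda_infty F.simps F_infty_def by (rule if_not_P)
      \<comment> \<open>The energy of \<open>Q\<close> is infinite, so any admissible map will do;
        the competitor from the other regime provides one.\<close>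
      obtain P where "P \<in> admissible (uniax e)"
        using competitor_zero[OF e(1) assms(3) e(2) Q] by blast
      then show ?thesis
        unfolding top by (intro bexI[of _ P]) auto
    qed
  qed
  then show ?thesis
    unfolding D_def by (intro INF_mono) auto
qed

end
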